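(* Let $(A,\ast,\circ,\varpi)$ be a (finite-dimensional) quasi-Frobenius pre-Poisson algebra, $(B=\oplus_{i\in\mathbb Z}B_i,\diamond,\omega)$ a quadratic $\mathbb Z$-graded perm algebra, and $(A\otimes B,\cdot,[-,-])$ the induced Poisson algebra, with $$(a_1\otimes b_1)(a_2\otimes b_2)=(a_1\ast a_2)\otimes(b_1\diamond b_2)+(a_2\ast a_1)\otimes(b_2\diamond b_1),$$ $$[a_1\otimes b_1,a_2\otimes b_2]=(a_1\circ a_2)\otimes(b_1\diamond b_2)-(a_2\circ a_1)\otimes(b_2\diamond b_1).$$ Define a bilinear form on $A\otimes B$ by $\mathcal B(a_1\otimes b_1,a_2\otimes b_2)=\varpi(a_1,a_2)\,\omega(b_1,b_2)$. Then $(A\otimes B,\cdot,[-,-],\mathcal B)$ is a quasi-Frobenius $\mathbb Z$-graded Poisson algebra. Furthermore, let $(B=\oplus_{i\in\mathbb Z}B_i,\diamond,\omega)$ be the Laurent quadratic $\mathbb Z$-graded perm algebra $B^L$ described in the context, let $(A,\ast,\circ)$ be a finite-dimensional pre-Poisson algebra and $\varpi$ a bilinear form on $A$. With $\cdot,[-,-],\mathcal B$ defined by the same formulas, $(A\otimes B,\cdot,[-,-],\mathcal B)$ is a quasi-Frobenius $\mathbb Z$-graded Poisson algebra if and only if $(A,\ast,\circ,\varpi)$ is a quasi-Frobenius pre-Poisson algebra.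
   Context: All vector spaces are over a field $\mathbf k$ of characteristic zero. A Zinbiel algebra $(A,\ast)$: $a_1\ast(a_2\ast a_3)=(a_1\ast a_2)\ast a_3+(a_2\ast a_1)\ast a_3$. A pre-Lie algebra $(A,\circ)$: $(a_1\circ a_2)\circ a_3-a_1\circ(a_2\circ a_3)=(a_2\circ a_1)\circ a_3-a_2\circ(a_1\circ a_3)$. A pre-Poisson algebra $(A,\ast,\circ)$: $(A,\ast)$ Zinbiel, $(A,\circ)$ pre-Lie, $(a_1\circ a_2-a_2\circ a_1)\ast a_3=a_1\circ(a_2\ast a_3)-a_2\ast(a_1\circ a_3)$, $(a_1\ast a_2+a_2\ast a_1)\circ a_3=a_1\ast(a_2\circ a_3)+a_2\ast(a_1\circ a_3)$. A quasi-Frobenius pre-Poisson algebra $(A,\ast,\circ,\varpi)$: a pre-Poisson algebra with a symmetric nondegenerate bilinear form $\varpi$ such that for all $a_1,a_2,a_3$: $\varpi(a_1\ast a_2+a_2\ast a_1,a_3)=\varpi(a_1,a_2\ast a_3)+\varpi(a_2,a_1\ast a_3)$, $\varpi(a_1\circ a_2,a_3)-\varpi(a_1,a_2\circ a_3)=\varpi(a_2\circ a_1,a_3)-\varpi(a_2,a_1\circ a_3)$. A perm algebra $(B,\diamond)$: $b_1\diamond(b_2\diamond b_3)=(b_1\diamond b_2)\diamond b_3=(b_2\diamond b_1)\diamond b_3$. $\mathbb Z$-graded algebra (perm, Poisson): $B=\oplus_{i\in\mathbb Z}B_i$, each $B_i$ finite-dimensional, all products mapping $B_i\times B_j$ into $B_{i+j}$.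 A bilinear form $\beta$ on a $\mathbb Z$-graded space is graded if for some $m\in\mathbb Z$, $\beta(B_i,B_j)=0$ whenever $i+j+m\ne0$. Quadratic $\mathbb Z$-graded perm algebra $(B,\diamond,\omega)$: a $\mathbb Z$-graded perm algebra with an antisymmetric nondegenerate graded bilinear form with $\omega(b_1\diamond b_2,b_3)=\omega(b_1,b_2\diamond b_3-b_3\diamond b_2)$. $A\otimes B$ is graded by $A\otimes B_i$. A Poisson algebra: commutative associative product, Lie bracket, $[p_1,p_2p_3]=[p_1,p_2]p_3+p_2[p_1,p_3]$. A quasi-Frobenius $\mathbb Z$-graded Poisson algebra $(P,\cdot,[-,-],\mathcal B)$: a $\mathbb Z$-graded Poisson algebra with an antisymmetric nondegenerate graded bilinear form such that $\mathcal B(p_1p_2,p_3)+\mathcal B(p_2p_3,p_1)+\mathcal B(p_3p_1,p_2)=0$ and $\mathcal B([p_1,p_2],p_3)+\mathcal B([p_2,p_3],p_1)+\mathcal B([p_3,p_1],p_2)=0$. Laurent quadratic $\mathbb Z$-graded perm algebra: $B^L=\{f_1\partial_1+f_2\partial_2\mid f_1,f_2\in\mathbf k[x_1^{\pm1},x_2^{\pm1}]\}$ with $(x_1^{i_1}x_2^{i_2}\partial_s)\diamond(x_1^{j_1}x_2^{j_2}\partial_t)=\delta_{s,1}x_1^{i_1+j_1+1}x_2^{i_2+j_2}\partial_t+\delta_{s,2}x_1^{i_1+j_1}x_2^{i_2+j_2+1}\partial_t$, regarded as $\mathbb Z$-graded by $B_i=\{f_1\partial_1+f_2\partial_2\mid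 f_1,f_2\text{ homogeneous of total degree }i-1\}$, $i\in\mathbb Z$; form: $\omega(x_1^{i_1}x_2^{i_2}\partial_2,x_1^{j_1}x_2^{j_2}\partial_1)=-\omega(x_1^{j_1}x_2^{j_2}\partial_1,x_1^{i_1}x_2^{i_2}\partial_2)=\delta_{i_1+j_1,0}\delta_{i_2+j_2,0}$ and $\omega(x_1^{i_1}x_2^{i_2}\partial_s,x_1^{j_1}x_2^{j_2}\partial_s)=0$ for $s=1,2$.
   Formalization: In the Laurent part, "ℤ-graded" is read without requiring finite-dimensional homogeneous components: the components of B^L, hence of A⊗B^L for A≠0, are infinite-dimensional, so with that requirement the stated equivalence would be false. *)

theory Defs
  imports Complex_Main "HOL-Library.Poly_Mapping" "HOL-Library.Product_Plus"
begin

section \<open>Linear algebra over an arbitrary field\<close>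

text \<open>
  A vector space over the field \<open>'k\<close> is a type \<open>'v :: ab_group_add\<close> with a scalar multiplication
  \<open>s\<close> such that \<^term>\<open>vector_space s\<close>.  The predicate \<^term>\<open>Vector_Spaces.linear s1 s2 f\<close>
  contains the assertion that both scalar multiplications are vector space structures, so
  \<open>bilinear_map\<close> below contains it for all three spaces.
\<close>

definition bilinear_map ::
    "('k::field \<Rightarrow> 'a::ab_group_add \<Rightarrow> 'a) \<Rightarrow> ('k \<Rightarrow> 'b::ab_group_add \<Rightarrow> 'b) \<Rightarrow>
     ('k \<Rightarrow> 'c::ab_group_add \<Rightarrow> 'c) \<Rightarrow> ('a \<Rightarrow> 'b \<Rightarrow> 'c) \<Rightarrow> bool" where
  "bilinear_map s1 s2 s3 f \<longleftrightarrow>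
     (\<forall>x. Vector_Spaces.linear s2 s3 (\<lambda>y. f x y)) \<and>
     (\<forall>y. Vector_Spaces.linear s1 s3 (\<lambda>x. f x y))"

abbreviation bilinear_op ::
    "('k::field \<Rightarrow> 'v::ab_group_add \<Rightarrow> 'v) \<Rightarrow> ('v \<Rightarrow> 'v \<Rightarrow> 'v) \<Rightarrow> bool" where
  "bilinear_op s m \<equiv> bilinear_map s s s m"

abbreviation bilinear_form ::
    "('k::field \<Rightarrow> 'v::ab_group_add \<Rightarrow> 'v) \<Rightarrow> ('v \<Rightarrow> 'v \<Rightarrow> 'k) \<Rightarrow> bool" where
  "bilinear_form s \<beta> \<equiv> bilinear_map s s (*) \<beta>"

definition symmetric_form :: "('v \<Rightarrow> 'v \<Rightarrow> 'k) \<Rightarrow> bool" where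
  "symmetric_form \<beta> \<longleftrightarrow> (\<forall>x y. \<beta> x y = \<beta> y x)"

definition antisymmetric_form :: "('v \<Rightarrow> 'v \<Rightarrow> 'k::uminus) \<Rightarrow> bool" where
  "antisymmetric_form \<beta> \<longleftrightarrow> (\<forall>x y. \<beta> x y = - \<beta> y x)"

definition nondegenerate_form :: "('v::zero \<Rightarrow> 'v \<Rightarrow> 'k::zero) \<Rightarrow> bool" where
  "nondegenerate_form \<beta> \<longleftrightarrow>
     (\<forall>x. (\<forall>y. \<beta> x y = 0) \<longrightarrow> x = 0) \<and> (\<forall>y. (\<forall>x. \<beta> x y = 0) \<longrightarrow> y = 0)"

definition fin_dim :: "('k::field \<Rightarrow> 'v::ab_group_add \<Rightarrow> 'v) \<Rightarrow> 'v set \<Rightarrow> bool" where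
  "fin_dim s V \<longleftrightarrow> (\<exists>S. finite S \<and> module.span s S = V)"


section \<open>Gradings by the integers\<close>

definition int_grading ::
    "('k::field \<Rightarrow> 'v::ab_group_add \<Rightarrow> 'v) \<Rightarrow> (int \<Rightarrow> 'v set) \<Rightarrow> bool" where
  "int_grading s G \<longleftrightarrow> vector_space s \<and> (\<forall>i. module.subspace s (G i)) \<and>
     (\<forall>x. \<exists>!c :: int \<Rightarrow> 'v. (\<forall>i. c i \<in> G i) \<and> finite {i. c i \<noteq> 0} \<and> x = (\<Sum>i | c i \<noteq> 0. c i))"

definition fin_dim_components ::
    "('k::field \<Rightarrow> 'v::ab_group_add \<Rightarrow> 'v) \<Rightarrow> (int \<Rightarrow> 'v set) \<Rightarrow> bool" where
  "fin_dim_components s G \<longleftrightarrow> (\<forall>i. fin_dim s (G i))"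

definition graded_op :: "(int \<Rightarrow> 'v set) \<Rightarrow> ('v \<Rightarrow> 'v \<Rightarrow> 'v) \<Rightarrow> bool" where
  "graded_op G m \<longleftrightarrow> (\<forall>i j. \<forall>x\<in>G i. \<forall>y\<in>G j. m x y \<in> G (i + j))"

definition graded_form :: "(int \<Rightarrow> 'v set) \<Rightarrow> ('v \<Rightarrow> 'v \<Rightarrow> 'k::zero) \<Rightarrow> bool" where
  "graded_form G \<beta> \<longleftrightarrow> (\<exists>m. \<forall>i j. i + j + m \<noteq> 0 \<longrightarrow> (\<forall>x\<in>G i. \<forall>y\<in>G j. \<beta> x y = 0))"


section \<open>Zinbiel, pre-Lie, pre-Poisson and perm algebras\<close>

definition zinbiel_algebra ::
    "('k::field \<Rightarrow> 'a::ab_group_add \<Rightarrow> 'a) \<Rightarrow> ('a \<Rightarrow> 'a \<Rightarrow> 'a) \<Rightarrow> bool" where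
  "zinbiel_algebra s ast \<longleftrightarrow> bilinear_op s ast \<and>
     (\<forall>x y z. ast x (ast y z) = ast (ast x y) z + ast (ast y x) z)"

definition pre_lie_algebra ::
    "('k::field \<Rightarrow> 'a::ab_group_add \<Rightarrow> 'a) \<Rightarrow> ('a \<Rightarrow> 'a \<Rightarrow> 'a) \<Rightarrow> bool" where
  "pre_lie_algebra s circ \<longleftrightarrow> bilinear_op s circ \<and>
     (\<forall>x y z. circ (circ x y) z - circ x (circ y z) = circ (circ y x) z - circ y (circ x z))"

definition pre_poisson_algebra ::
    "('k::field \<Rightarrow> 'a::ab_group_add \<Rightarrow> 'a) \<Rightarrow> ('a \<Rightarrow> 'a \<Rightarrow> 'a) \<Rightarrow> ('a \<Rightarrow> 'a \<Rightarrow> 'a) \<Rightarrow> bool" where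
  "pre_poisson_algebra s ast circ \<longleftrightarrow> zinbiel_algebra s ast \<and> pre_lie_algebra s circ \<and>
     (\<forall>x y z. ast (circ x y - circ y x) z = circ x (ast y z) - ast y (circ x z)) \<and>
     (\<forall>x y z. circ (ast x y + ast y x) z = ast x (circ y z) + ast y (circ x z))"

definition quasi_frobenius_pre_poisson_algebra ::
    "('k::field \<Rightarrow> 'a::ab_group_add \<Rightarrow> 'a) \<Rightarrow> ('a \<Rightarrow> 'a \<Rightarrow> 'a) \<Rightarrow> ('a \<Rightarrow> 'a \<Rightarrow> 'a) \<Rightarrow>
     ('a \<Rightarrow> 'a \<Rightarrow> 'k) \<Rightarrow> bool" where
  "quasi_frobenius_pre_poisson_algebra s ast circ \<beta> \<longleftrightarrow>
     pre_poisson_algebra s ast circ \<and>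
     bilinear_form s \<beta> \<and> symmetric_form \<beta> \<and> nondegenerate_form \<beta> \<and>
     (\<forall>x y z. \<beta> (ast x y + ast y x) z = \<beta> x (ast y z) + \<beta> y (ast x z)) \<and>
     (\<forall>x y z. \<beta> (circ x y) z - \<beta> x (circ y z) = \<beta> (circ y x) z - \<beta> y (circ x z))"

definition perm_algebra ::
    "('k::field \<Rightarrow> 'b::ab_group_add \<Rightarrow> 'b) \<Rightarrow> ('b \<Rightarrow> 'b \<Rightarrow> 'b) \<Rightarrow> bool" where
  "perm_algebra s dia \<longleftrightarrow> bilinear_op s dia \<and>
     (\<forall>x y z. dia x (dia y z) = dia (dia x y) z \<and> dia (dia x y) z = dia (dia y x) z)"

definition quadratic_graded_perm_algebra ::
    "('k::field \<Rightarrow> 'b::ab_group_add \<Rightarrow> 'b) \<Rightarrow> (int \<Rightarrow> 'b set) \<Rightarrow> ('b \<Rightarrow> 'b \<Rightarrow> 'b) \<Rightarrow>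
     ('b \<Rightarrow> 'b \<Rightarrow> 'k) \<Rightarrow> bool" where
  "quadratic_graded_perm_algebra s G dia \<omega> \<longleftrightarrow>
     perm_algebra s dia \<and> int_grading s G \<and> fin_dim_components s G \<and> graded_op G dia \<and>
     bilinear_form s \<omega> \<and> antisymmetric_form \<omega> \<and> nondegenerate_form \<omega> \<and> graded_form G \<omega> \<and>
     (\<forall>x y z. \<omega> (dia x y) z = \<omega> x (dia y z - dia z y))"


section \<open>Poisson algebras\<close>

definition poisson_algebra ::
    "('k::field \<Rightarrow> 'p::ab_group_add \<Rightarrow> 'p) \<Rightarrow> ('p \<Rightarrow> 'p \<Rightarrow> 'p) \<Rightarrow> ('p \<Rightarrow> 'p \<Rightarrow> 'p) \<Rightarrow> bool" where
  "poisson_algebra s mul brk \<longleftrightarrow>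
     bilinear_op s mul \<and>
     (\<forall>x y. mul x y = mul y x) \<and>
     (\<forall>x y z. mul (mul x y) z = mul x (mul y z)) \<and>
     bilinear_op s brk \<and>
     (\<forall>x. brk x x = 0) \<and>
     (\<forall>x y z. brk x (brk y z) + brk y (brk z x) + brk z (brk x y) = 0) \<and>
     (\<forall>x y z. brk x (mul y z) = mul (brk x y) z + mul y (brk x z))"

text \<open>
  Two versions of a quasi-Frobenius graded Poisson algebra are needed: the first one allows
  homogeneous components of infinite dimension, the second one does not.  The Laurent perm algebra
  below has infinite-dimensional components, since there are infinitely many Laurent monomials in
  two variables of any given total degree.
\<close>

definition quasi_frobenius_graded_poisson_algebra_any_dim ::
    "('k::field \<Rightarrow> 'p::ab_group_add \<Rightarrow> 'p) \<Rightarrow> (int \<Rightarrow> 'p set) \<Rightarrow>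
     ('p \<Rightarrow> 'p \<Rightarrow> 'p) \<Rightarrow> ('p \<Rightarrow> 'p \<Rightarrow> 'p) \<Rightarrow> ('p \<Rightarrow> 'p \<Rightarrow> 'k) \<Rightarrow> bool" where
  "quasi_frobenius_graded_poisson_algebra_any_dim s G mul brk \<beta> \<longleftrightarrow>
     poisson_algebra s mul brk \<and> int_grading s G \<and> graded_op G mul \<and> graded_op G brk \<and>
     bilinear_form s \<beta> \<and> antisymmetric_form \<beta> \<and> nondegenerate_form \<beta> \<and> graded_form G \<beta> \<and>
     (\<forall>x y z. \<beta> (mul x y) z + \<beta> (mul y z) x + \<beta> (mul z x) y = 0) \<and>
     (\<forall>x y z. \<beta> (brk x y) z + \<beta> (brk y z) x + \<beta> (brk z x) y = 0)"

definition quasi_frobenius_graded_poisson_algebra ::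
    "('k::field \<Rightarrow> 'p::ab_group_add \<Rightarrow> 'p) \<Rightarrow> (int \<Rightarrow> 'p set) \<Rightarrow>
     ('p \<Rightarrow> 'p \<Rightarrow> 'p) \<Rightarrow> ('p \<Rightarrow> 'p \<Rightarrow> 'p) \<Rightarrow> ('p \<Rightarrow> 'p \<Rightarrow> 'k) \<Rightarrow> bool" where
  "quasi_frobenius_graded_poisson_algebra s G mul brk \<beta> \<longleftrightarrow>
     quasi_frobenius_graded_poisson_algebra_any_dim s G mul brk \<beta> \<and> fin_dim_components s G"


section \<open>Tensor products\<close>

text \<open>
  The free vector space on the set of pairs \<open>(a, b)\<close> is the type \<open>('a \<times> 'b) \<Rightarrow>\<^sub>0 'k\<close>.
  A vector space \<open>T\<close> with a map \<open>tens\<close> is a tensor product of \<open>A\<close> and \<open>B\<close> if the linear map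
  sending the basis vector \<open>(a, b)\<close> to \<open>tens a b\<close> is onto and its kernel is spanned by the usual
  relators; that is, it identifies \<open>T\<close> with the quotient of the free vector space by the span of
  the relators, and \<open>tens a b\<close> with the class of \<open>(a, b)\<close>.  As the scalar multiplications of
  \<open>A\<close> and \<open>B\<close> are terms, this quotient cannot be introduced as a type depending on them.
\<close>

definition free_scale :: "'k::field \<Rightarrow> ('x \<Rightarrow>\<^sub>0 'k) \<Rightarrow> ('x \<Rightarrow>\<^sub>0 'k)" where
  "free_scale c = Poly_Mapping.map ((*) c)"

definition free_extend ::
    "('k::field \<Rightarrow> 'w::ab_group_add \<Rightarrow> 'w) \<Rightarrow> ('x \<Rightarrow> 'w) \<Rightarrow> ('x \<Rightarrow>\<^sub>0 'k) \<Rightarrow> 'w" where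
  "free_extend s f u = (\<Sum>p\<in>Poly_Mapping.keys u. s (Poly_Mapping.lookup u p) (f p))"

definition tensor_relators ::
    "('k::field \<Rightarrow> 'a::ab_group_add \<Rightarrow> 'a) \<Rightarrow> ('k \<Rightarrow> 'b::ab_group_add \<Rightarrow> 'b) \<Rightarrow>
     (('a \<times> 'b) \<Rightarrow>\<^sub>0 'k) set" where
  "tensor_relators sA sB =
     {Poly_Mapping.single (a + a', b) 1 - Poly_Mapping.single (a, b) 1
        - Poly_Mapping.single (a', b) 1 | a a' b. True} \<union>
     {Poly_Mapping.single (a, b + b') 1 - Poly_Mapping.single (a, b) 1
        - Poly_Mapping.single (a, b') 1 | a b b'. True} \<union>
     {Poly_Mapping.single (sA c a, b) 1 - Poly_Mapping.single (a, b) c | c a b. True} \<union>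
     {Poly_Mapping.single (a, sB c b) 1 - Poly_Mapping.single (a, b) c | c a b. True}"

definition is_tensor_product ::
    "('k::field \<Rightarrow> 'a::ab_group_add \<Rightarrow> 'a) \<Rightarrow> ('k \<Rightarrow> 'b::ab_group_add \<Rightarrow> 'b) \<Rightarrow>
     ('k \<Rightarrow> 't::ab_group_add \<Rightarrow> 't) \<Rightarrow> ('a \<Rightarrow> 'b \<Rightarrow> 't) \<Rightarrow> bool" where
  "is_tensor_product sA sB sT tens \<longleftrightarrow>
     vector_space sA \<and> vector_space sB \<and> vector_space sT \<and>
     surj (free_extend sT (\<lambda>(a, b). tens a b)) \<and>
     {u. free_extend sT (\<lambda>(a, b). tens a b) u = 0} =
       module.span free_scale (tensor_relators sA sB)"

text \<open>
  The operations on \<open>T\<close> are prescribed on pure tensors and extended bilinearly.  That such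
  extensions exist and are unique follows from \<open>tensor_bilinear_universal\<close> below; see
  also \<open>tensor_mult_props\<close>, \<open>tensor_bracket_props\<close> and
  \<open>tensor_form_props\<close>.
\<close>

definition tensor_mult ::
    "('k::field \<Rightarrow> 't::ab_group_add \<Rightarrow> 't) \<Rightarrow> ('a \<Rightarrow> 'b \<Rightarrow> 't) \<Rightarrow>
     ('a \<Rightarrow> 'a \<Rightarrow> 'a) \<Rightarrow> ('b \<Rightarrow> 'b \<Rightarrow> 'b) \<Rightarrow> 't \<Rightarrow> 't \<Rightarrow> 't" where
  "tensor_mult sT tens ast dia = (THE m. bilinear_op sT m \<and>
     (\<forall>a1 b1 a2 b2. m (tens a1 b1) (tens a2 b2) =
        tens (ast a1 a2) (dia b1 b2) + tens (ast a2 a1) (dia b2 b1)))"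

definition tensor_bracket ::
    "('k::field \<Rightarrow> 't::ab_group_add \<Rightarrow> 't) \<Rightarrow> ('a \<Rightarrow> 'b \<Rightarrow> 't) \<Rightarrow>
     ('a \<Rightarrow> 'a \<Rightarrow> 'a) \<Rightarrow> ('b \<Rightarrow> 'b \<Rightarrow> 'b) \<Rightarrow> 't \<Rightarrow> 't \<Rightarrow> 't" where
  "tensor_bracket sT tens circ dia = (THE m. bilinear_op sT m \<and>
     (\<forall>a1 b1 a2 b2. m (tens a1 b1) (tens a2 b2) =
        tens (circ a1 a2) (dia b1 b2) - tens (circ a2 a1) (dia b2 b1)))"

definition tensor_form ::
    "('k::field \<Rightarrow> 't::ab_group_add \<Rightarrow> 't) \<Rightarrow> ('a \<Rightarrow> 'b \<Rightarrow> 't) \<Rightarrow>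
     ('a \<Rightarrow> 'a \<Rightarrow> 'k) \<Rightarrow> ('b \<Rightarrow> 'b \<Rightarrow> 'k) \<Rightarrow> 't \<Rightarrow> 't \<Rightarrow> 'k" where
  "tensor_form sT tens \<beta> \<omega> = (THE m. bilinear_form sT m \<and>
     (\<forall>a1 b1 a2 b2. m (tens a1 b1) (tens a2 b2) = \<beta> a1 a2 * \<omega> b1 b2))"

text \<open>The subspaces \<open>A \<otimes> B\<^sub>i\<close>.\<close>

definition tensor_grading ::
    "('k::field \<Rightarrow> 't::ab_group_add \<Rightarrow> 't) \<Rightarrow> ('a \<Rightarrow> 'b \<Rightarrow> 't) \<Rightarrow> (int \<Rightarrow> 'b set) \<Rightarrow> int \<Rightarrow> 't set" where
  "tensor_grading sT tens G i = module.span sT {tens a b | a b. b \<in> G i}"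


section \<open>The Laurent perm algebra\<close>

text \<open>
  As the exponents form the group \<open>int \<times> int\<close>, the ring \<open>(int \<times> int) \<Rightarrow>\<^sub>0 'k\<close> with the convolution
  product is the ring of Laurent polynomials in \<open>x\<^sub>1\<close> and \<open>x\<^sub>2\<close>, and the pair \<open>(f1, f2)\<close> stands for
  \<open>f1 \<partial>\<^sub>1 + f2 \<partial>\<^sub>2\<close>.  The product and the form are the bilinear extensions of the formulas on
  monomials, see \<open>laurent_perm_monom\<close> and \<open>laurent_form_monom\<close> below.
\<close>

type_synonym 'k laurent = "(int \<times> int) \<Rightarrow>\<^sub>0 'k"
type_synonym 'k laurent_der = "'k laurent \<times> 'k laurent"

definition laurent_scale :: "'k::field \<Rightarrow> 'k laurent_der \<Rightarrow> 'k laurent_der" where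
  "laurent_scale c = map_prod (free_scale c) (free_scale c)"

definition laurent_perm :: "'k::field laurent_der \<Rightarrow> 'k laurent_der \<Rightarrow> 'k laurent_der" where
  "laurent_perm f g =
     (let h = Poly_Mapping.single (1, 0) 1 * fst f + Poly_Mapping.single (0, 1) 1 * snd f
      in (h * fst g, h * snd g))"

definition laurent_form :: "'k::field laurent_der \<Rightarrow> 'k laurent_der \<Rightarrow> 'k" where
  "laurent_form f g = Poly_Mapping.lookup (snd f * fst g - fst f * snd g) (0, 0)"

definition laurent_grading :: "int \<Rightarrow> 'k::field laurent_der set" where
  "laurent_grading i =
     {f. \<forall>(p, q) \<in> Poly_Mapping.keys (fst f) \<union> Poly_Mapping.keys (snd f). p + q = i - 1}"

text \<open>\<open>laurent_monom s p q\<close> is \<open>x\<^sub>1\<^sup>p x\<^sub>2\<^sup>q \<partial>\<^sub>s\<close> for \<open>s \<in> {1, 2}\<close>.\<close>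

definition laurent_monom :: "nat \<Rightarrow> int \<Rightarrow> int \<Rightarrow> 'k::field laurent_der" where
  "laurent_monom s p q =
     (if s = 1 then (Poly_Mapping.single (p, q) 1, 0) else (0, Poly_Mapping.single (p, q) 1))"


section \<open>The definitions by bilinear extension are meaningful\<close>

lemma lookup_free_scale [simp]:
  "Poly_Mapping.lookup (free_scale c u) x = c * Poly_Mapping.lookup u x"
  unfolding free_scale_def by (transfer; simp add: when_def)

lemma vector_space_free_scale: "vector_space free_scale"
  by unfold_locales (auto intro!: poly_mapping_eqI simp: lookup_add algebra_simps)

lemma vector_space_field: "vector_space ((*) :: 'k::field \<Rightarrow> 'k \<Rightarrow> 'k)"
  by unfold_locales (auto simp: algebra_simps)

lemma free_extend_superset:
  assumes "vector_space s" "finite S" "Poly_Mapping.keys u \<subseteq> S"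
  shows "free_extend s f u = (\<Sum>p\<in>S. s (Poly_Mapping.lookup u p) (f p))"
proof -
  interpret vector_space s by fact
  show ?thesis unfolding free_extend_def
    using assms(2,3) by (intro sum.mono_neutral_left) (auto simp: in_keys_iff)
qed

lemma linear_free_extend:
  assumes "vector_space s"
  shows "Vector_Spaces.linear free_scale s (free_extend s f)"
proof -
  interpret vector_space s by fact
  have add: "free_extend s f (u + v) = free_extend s f u + free_extend s f v" for u v
  proof -
    let ?S = "Poly_Mapping.keys u \<union> Poly_Mapping.keys v"
    have "Poly_Mapping.keys (u + v) \<subseteq> ?S" by (rule keys_add)
    then show ?thesis
      using assms by (simp add: free_extend_superset[where S = ?S] lookup_add
          scale_left_distrib sum.distrib)
  qed
  have scl: "free_extend s f (free_scale c u) = s c (free_extend s f u)" for c u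
  proof -
    have "Poly_Mapping.keys (free_scale c u) \<subseteq> Poly_Mapping.keys u"
      by (auto simp: in_keys_iff)
    then show ?thesis
      using assms by (simp add: free_extend_superset[where S = "Poly_Mapping.keys u"]
          scale_sum_right)
  qed
  show ?thesis
    unfolding Vector_Spaces.linear_iff using assms vector_space_free_scale add scl by blast
qed

lemma free_extend_single [simp]:
  assumes "vector_space s"
  shows "free_extend s f (Poly_Mapping.single p c) = s c (f p)"
proof -
  interpret vector_space s by fact
  show ?thesis by (cases "c = 0") (simp_all add: free_extend_def)
qed

lemma free_extend_relator:
  assumes f: "bilinear_map sA sB sW f" and u: "u \<in> module.span free_scale (tensor_relators sA sB)"
  shows "free_extend sW (\<lambda>(a, b). f a b) u = 0"
proof -
  have W: "vector_space sW" using f unfolding bilinear_map_def Vector_Spaces.linear_iff by blast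
  interpret F: vector_space "free_scale :: 'a \<Rightarrow> ('b \<times> 'c \<Rightarrow>\<^sub>0 'a) \<Rightarrow> _"
    by (rule vector_space_free_scale)
  interpret W: vector_space sW by (rule W)
  let ?E = "free_extend sW (\<lambda>(a, b). f a b)"
  interpret L: Vector_Spaces.linear free_scale sW ?E by (rule linear_free_extend[OF W])
  have rel: "?E r = 0" if "r \<in> tensor_relators sA sB" for r
    using that f unfolding tensor_relators_def bilinear_map_def Vector_Spaces.linear_iff
    by (auto simp: L.diff free_extend_single[OF W])
  show ?thesis using u
    by (induction rule: F.span_induct_alt) (auto simp: rel L.add L.scale)
qed

lemma tensor_bilinear:
  assumes "is_tensor_product sA sB sT tens"
  shows "bilinear_map sA sB sT tens"
proof -
  from assms have vs: "vector_space sA" "vector_space sB" "vector_space sT"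
    and ker: "\<And>u. u \<in> module.span free_scale (tensor_relators sA sB) \<Longrightarrow>
      free_extend sT (\<lambda>(a, b). tens a b) u = 0"
    unfolding is_tensor_product_def by auto
  interpret F: vector_space "free_scale :: 'a \<Rightarrow> ('b \<times> 'c \<Rightarrow>\<^sub>0 'a) \<Rightarrow> _"
    by (rule vector_space_free_scale)
  interpret T: vector_space sT by (rule vs)
  let ?E = "free_extend sT (\<lambda>(a, b). tens a b)"
  interpret L: Vector_Spaces.linear free_scale sT ?E by (rule linear_free_extend[OF vs(3)])
  have rel: "?E r = 0" if "r \<in> tensor_relators sA sB" for r
    using that ker F.span_base by blast
  note [simp] = L.diff free_extend_single[OF vs(3)]
  have 1: "tens (a + a') b = tens a b + tens a' b" for a a' b
  proof -
    have "Poly_Mapping.single (a + a', b) 1 - Poly_Mapping.single (a, b) 1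
        - Poly_Mapping.single (a', b) 1 \<in> tensor_relators sA sB"
      unfolding tensor_relators_def by blast
    from rel[OF this] show ?thesis by (simp add: diff_eq_eq add.commute)
  qed
  have 2: "tens a (b + b') = tens a b + tens a b'" for a b b'
  proof -
    have "Poly_Mapping.single (a, b + b') 1 - Poly_Mapping.single (a, b) 1
        - Poly_Mapping.single (a, b') 1 \<in> tensor_relators sA sB"
      unfolding tensor_relators_def by blast
    from rel[OF this] show ?thesis by (simp add: diff_eq_eq add.commute)
  qed
  have 3: "tens (sA c a) b = sT c (tens a b)" for c a b
  proof -
    have "Poly_Mapping.single (sA c a, b) 1 - Poly_Mapping.single (a, b) c \<in> tensor_relators sA sB"
      unfolding tensor_relators_def by blast
    from rel[OF this] show ?thesis by simp
  qed
  have 4: "tens a (sB c b) = sT c (tens a b)" for c a b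
  proof -
    have "Poly_Mapping.single (a, sB c b) 1 - Poly_Mapping.single (a, b) c \<in> tensor_relators sA sB"
      unfolding tensor_relators_def by blast
    from rel[OF this] show ?thesis by simp
  qed
  show ?thesis unfolding bilinear_map_def Vector_Spaces.linear_iff using vs 1 2 3 4 by auto
qed

lemma tensor_linear_unique:
  assumes T: "is_tensor_product sA sB sT tens"
    and g: "Vector_Spaces.linear sT sW g" and h: "Vector_Spaces.linear sT sW h"
    and eq: "\<And>a b. g (tens a b) = h (tens a b)"
  shows "g = h"
proof
  fix t
  interpret G: Vector_Spaces.linear sT sW g by fact
  interpret H: Vector_Spaces.linear sT sW h by fact
  from T obtain u where "t = free_extend sT (\<lambda>(a, b). tens a b) u"
    unfolding is_tensor_product_def by (meson surjD)
  then show "g t = h t"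
    by (auto simp: free_extend_def G.sum H.sum G.scale H.scale eq intro!: sum.cong)
qed

text \<open>The universal property of the tensor product.\<close>

lemma tensor_universal:
  assumes T: "is_tensor_product sA sB sT tens" and f: "bilinear_map sA sB sW f"
  shows "\<exists>!g. Vector_Spaces.linear sT sW g \<and> (\<forall>a b. g (tens a b) = f a b)"
proof (rule ex_ex1I)
  have vT: "vector_space sT" using T unfolding is_tensor_product_def by blast
  have vW: "vector_space sW" using f unfolding bilinear_map_def Vector_Spaces.linear_iff by blast
  let ?E = "free_extend sT (\<lambda>(a, b). tens a b)" and ?F = "free_extend sW (\<lambda>(a, b). f a b)"
  interpret E: Vector_Spaces.linear free_scale sT ?E by (rule linear_free_extend[OF vT])
  interpret F: Vector_Spaces.linear free_scale sW ?F by (rule linear_free_extend[OF vW])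
  have EF: "?F u = ?F v" if "?E u = ?E v" for u v
  proof -
    have "?E (u - v) = 0" using that by (simp add: E.diff)
    then have "u - v \<in> module.span free_scale (tensor_relators sA sB)"
      using T unfolding is_tensor_product_def by blast
    from free_extend_relator[OF f this] show ?thesis by (simp add: F.diff)
  qed
  have ex: "\<exists>u. ?E u = t" for t using T unfolding is_tensor_product_def by (metis surjD)
  define g where "g t = ?F (SOME u. ?E u = t)" for t
  have gE: "g (?E u) = ?F u" for u
    unfolding g_def by (rule EF, rule someI[of "\<lambda>v. ?E v = ?E u" u]) simp
  have "g (t + t') = g t + g t'" for t t'
    using ex[of t] ex[of t'] by (metis gE E.add F.add)
  moreover have "g (sT c t) = sW c (g t)" for c t
    using ex[of t] by (metis gE E.scale F.scale)
  moreover have "g (tens a b) = f a b" for a b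
    using gE[of "Poly_Mapping.single (a, b) 1"] vT vW
    by (simp add: vector_space.vector_space_assms)
  ultimately show "\<exists>g. Vector_Spaces.linear sT sW g \<and> (\<forall>a b. g (tens a b) = f a b)"
    unfolding Vector_Spaces.linear_iff using vT vW by blast
next
  fix g h
  assume "Vector_Spaces.linear sT sW g \<and> (\<forall>a b. g (tens a b) = f a b)"
    "Vector_Spaces.linear sT sW h \<and> (\<forall>a b. h (tens a b) = f a b)"
  then show "g = h" using tensor_linear_unique[OF T, of sW g h] by simp
qed

lemma tensor_bilinear_universal:
  assumes T: "is_tensor_product sA sB sT tens"
    and f1: "\<And>a2 b2. bilinear_map sA sB sW (\<lambda>a1 b1. f a1 b1 a2 b2)"
    and f2: "\<And>a1 b1. bilinear_map sA sB sW (\<lambda>a2 b2. f a1 b1 a2 b2)"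
  shows "\<exists>!m. bilinear_map sT sT sW m \<and>
    (\<forall>a1 b1 a2 b2. m (tens a1 b1) (tens a2 b2) = f a1 b1 a2 b2)"
proof (rule ex_ex1I)
  have vs: "vector_space sA" "vector_space sB" "vector_space sT"
    using T unfolding is_tensor_product_def by blast+
  have vW: "vector_space sW" using f1 unfolding bilinear_map_def Vector_Spaces.linear_iff by blast
  interpret W: vector_space sW by fact
  interpret TW: vector_space_pair sT sW by (intro vector_space_pair.intro vs vW)
  have "\<exists>g. Vector_Spaces.linear sT sW g \<and> (\<forall>a2 b2. g (tens a2 b2) = f a1 b1 a2 b2)" for a1 b1
    using tensor_universal[OF T f2] by blast
  then obtain g where lg: "\<And>a1 b1. Vector_Spaces.linear sT sW (g a1 b1)"
    and gt: "\<And>a1 b1 a2 b2. g a1 b1 (tens a2 b2) = f a1 b1 a2 b2" by metis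
  have f1': "f (a + a') b a2 b2 = f a b a2 b2 + f a' b a2 b2"
    "f a (b + b') a2 b2 = f a b a2 b2 + f a b' a2 b2"
    "f (sA c a) b a2 b2 = sW c (f a b a2 b2)" "f a (sB c b) a2 b2 = sW c (f a b a2 b2)"
    for a a' b b' c a2 b2
    using f1[of a2 b2] unfolding bilinear_map_def Vector_Spaces.linear_iff by auto
  note U = tensor_linear_unique[OF T]
  have g1: "g (a + a') b = (\<lambda>t. g a b t + g a' b t)" for a a' b
    by (rule U[OF lg]) (auto intro: TW.linear_compose_add lg simp: gt f1')
  have g2: "g a (b + b') = (\<lambda>t. g a b t + g a b' t)" for a b b'
    by (rule U[OF lg]) (auto intro: TW.linear_compose_add lg simp: gt f1')
  have g3: "g (sA c a) b = (\<lambda>t. sW c (g a b t))" for c a b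
    by (rule U[OF lg]) (auto intro: TW.linear_compose_scale_right lg simp: gt f1')
  have g4: "g a (sB c b) = (\<lambda>t. sW c (g a b t))" for c a b
    by (rule U[OF lg]) (auto intro: TW.linear_compose_scale_right lg simp: gt f1')
  have "bilinear_map sA sB sW (\<lambda>a b. g a b t)" for t
    unfolding bilinear_map_def Vector_Spaces.linear_iff using vs vW by (auto simp: g1 g2 g3 g4)
  then have "\<exists>h. Vector_Spaces.linear sT sW h \<and> (\<forall>a b. h (tens a b) = g a b t)" for t
    using tensor_universal[OF T] by blast
  then obtain h where lh: "\<And>t. Vector_Spaces.linear sT sW (h t)"
    and ht: "\<And>t a b. h t (tens a b) = g a b t" by metis
  have h1: "h (t + t') = (\<lambda>x. h t x + h t' x)" for t t'
  proof (rule U[OF lh])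
    show "Vector_Spaces.linear sT sW (\<lambda>x. h t x + h t' x)"
      by (rule TW.linear_compose_add[OF lh lh])
  qed (use lg in \<open>auto simp: ht Vector_Spaces.linear_iff\<close>)
  have h2: "h (sT c t) = (\<lambda>x. sW c (h t x))" for c t
  proof (rule U[OF lh])
    show "Vector_Spaces.linear sT sW (\<lambda>x. sW c (h t x))"
      by (rule TW.linear_compose_scale_right[OF lh])
  qed (use lg in \<open>auto simp: ht Vector_Spaces.linear_iff\<close>)
  have "bilinear_map sT sT sW (\<lambda>x t. h t x)"
    unfolding bilinear_map_def using lh vs vW by (auto simp: Vector_Spaces.linear_iff h1 h2)
  moreover have "\<forall>a1 b1 a2 b2. h (tens a2 b2) (tens a1 b1) = f a1 b1 a2 b2"
    by (simp add: ht gt)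
  ultimately show "\<exists>m. bilinear_map sT sT sW m \<and>
      (\<forall>a1 b1 a2 b2. m (tens a1 b1) (tens a2 b2) = f a1 b1 a2 b2)"
    by (intro exI[of _ "\<lambda>x t. h t x"]) simp
next
  fix m n
  assume mn: "bilinear_map sT sT sW m \<and>
      (\<forall>a1 b1 a2 b2. m (tens a1 b1) (tens a2 b2) = f a1 b1 a2 b2)"
    "bilinear_map sT sT sW n \<and>
      (\<forall>a1 b1 a2 b2. n (tens a1 b1) (tens a2 b2) = f a1 b1 a2 b2)"
  then have lin: "\<And>x. Vector_Spaces.linear sT sW (m x)" "\<And>x. Vector_Spaces.linear sT sW (n x)"
    "\<And>y. Vector_Spaces.linear sT sW (\<lambda>x. m x y)" "\<And>y. Vector_Spaces.linear sT sW (\<lambda>x. n x y)"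
    unfolding bilinear_map_def by auto
  have "m (tens a b) = n (tens a b)" for a b
    by (rule tensor_linear_unique[OF T lin(1) lin(2)]) (use mn in simp)
  then have "(\<lambda>x. m x y) = (\<lambda>x. n x y)" for y
    by (intro tensor_linear_unique[OF T lin(3) lin(4)]) simp
  then show "m = n" by (metis ext)
qed

lemma tensor_mult_props:
  assumes T: "is_tensor_product sA sB sT tens" and "bilinear_op sA ast" "bilinear_op sB dia"
  shows "bilinear_op sT (tensor_mult sT tens ast dia)"
    and "tensor_mult sT tens ast dia (tens a1 b1) (tens a2 b2) =
      tens (ast a1 a2) (dia b1 b2) + tens (ast a2 a1) (dia b2 b1)"
proof -
  have vT: "vector_space sT" using T unfolding is_tensor_product_def by blast
  have ex: "\<exists>!m. bilinear_op sT m \<and> (\<forall>a1 b1 a2 b2. m (tens a1 b1) (tens a2 b2) =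
      tens (ast a1 a2) (dia b1 b2) + tens (ast a2 a1) (dia b2 b1))"
    using tensor_bilinear[OF T] assms(2,3) vT
    by (intro tensor_bilinear_universal[OF T])
      (simp_all add: bilinear_map_def Vector_Spaces.linear_iff vector_space.vector_space_assms)
  from theI'[OF ex]
  show "bilinear_op sT (tensor_mult sT tens ast dia)"
    and "tensor_mult sT tens ast dia (tens a1 b1) (tens a2 b2) =
      tens (ast a1 a2) (dia b1 b2) + tens (ast a2 a1) (dia b2 b1)"
    unfolding tensor_mult_def by auto
qed

lemma tensor_bracket_props:
  assumes T: "is_tensor_product sA sB sT tens" and "bilinear_op sA circ" "bilinear_op sB dia"
  shows "bilinear_op sT (tensor_bracket sT tens circ dia)"
    and "tensor_bracket sT tens circ dia (tens a1 b1) (tens a2 b2) =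
      tens (circ a1 a2) (dia b1 b2) - tens (circ a2 a1) (dia b2 b1)"
proof -
  have vT: "vector_space sT" using T unfolding is_tensor_product_def by blast
  interpret vector_space sT by fact
  have ex: "\<exists>!m. bilinear_op sT m \<and> (\<forall>a1 b1 a2 b2. m (tens a1 b1) (tens a2 b2) =
      tens (circ a1 a2) (dia b1 b2) - tens (circ a2 a1) (dia b2 b1))"
    using tensor_bilinear[OF T] assms(2,3) vT
    by (intro tensor_bilinear_universal[OF T])
      (simp_all add: bilinear_map_def Vector_Spaces.linear_iff scale_right_diff_distrib)
  from theI'[OF ex]
  show "bilinear_op sT (tensor_bracket sT tens circ dia)"
    and "tensor_bracket sT tens circ dia (tens a1 b1) (tens a2 b2) =
      tens (circ a1 a2) (dia b1 b2) - tens (circ a2 a1) (dia b2 b1)"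
    unfolding tensor_bracket_def by auto
qed

lemma tensor_form_props:
  assumes T: "is_tensor_product sA sB sT tens" and "bilinear_form sA \<beta>" "bilinear_form sB \<omega>"
  shows "bilinear_form sT (tensor_form sT tens \<beta> \<omega>)"
    and "tensor_form sT tens \<beta> \<omega> (tens a1 b1) (tens a2 b2) = \<beta> a1 a2 * \<omega> b1 b2"
proof -
  have ex: "\<exists>!m. bilinear_form sT m \<and>
      (\<forall>a1 b1 a2 b2. m (tens a1 b1) (tens a2 b2) = \<beta> a1 a2 * \<omega> b1 b2)"
    using tensor_bilinear[OF T] assms(2,3)
    by (intro tensor_bilinear_universal[OF T])
      (simp_all add: bilinear_map_def Vector_Spaces.linear_iff distrib_left distrib_right)
  from theI'[OF ex]
  show "bilinear_form sT (tensor_form sT tens \<beta> \<omega>)"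
    and "tensor_form sT tens \<beta> \<omega> (tens a1 b1) (tens a2 b2) = \<beta> a1 a2 * \<omega> b1 b2"
    unfolding tensor_form_def by auto
qed

lemmas free_scale_simps = vector_space.vector_space_assms[OF vector_space_free_scale]

lemma free_scale_mult:
  fixes f g :: "'k::field laurent"
  shows "free_scale c f * g = free_scale c (f * g)" "f * free_scale c g = free_scale c (f * g)"
  unfolding free_scale_def mult_map_scale_conv_mult
  by (simp only: mult.assoc) (simp only: mult.left_commute)

lemma vector_space_laurent_scale: "vector_space laurent_scale"
  by unfold_locales (simp_all add: laurent_scale_def prod_eq_iff free_scale_simps)

lemma laurent_perm_bilinear: "bilinear_op laurent_scale laurent_perm"
  unfolding bilinear_map_def Vector_Spaces.linear_iff
  using vector_space_laurent_scale
  by (simp add: laurent_perm_def laurent_scale_def prod_eq_iff Let_def free_scale_mult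
      free_scale_simps distrib_left distrib_right add_ac)

lemma laurent_form_bilinear: "bilinear_form laurent_scale laurent_form"
  unfolding bilinear_map_def Vector_Spaces.linear_iff
  using vector_space_laurent_scale vector_space_field
  by (simp add: laurent_form_def laurent_scale_def free_scale_mult distrib_left distrib_right
      right_diff_distrib lookup_add lookup_minus)

lemma laurent_perm_monom:
  assumes "s \<in> {1, 2}"
  shows "laurent_perm (laurent_monom s i1 i2) (laurent_monom t j1 j2) =
     (if s = 1 then laurent_monom t (i1 + j1 + 1) (i2 + j2)
      else laurent_monom t (i1 + j1) (i2 + j2 + 1))"
  by (auto simp: laurent_perm_def laurent_monom_def mult_single add_ac)

lemma laurent_form_monom:
  "laurent_form (laurent_monom 2 i1 i2) (laurent_monom 1 j1 j2) =
     (if i1 + j1 = 0 \<and> i2 + j2 = 0 then 1 else 0)"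
  "laurent_form (laurent_monom 1 j1 j2) (laurent_monom 2 i1 i2) =
     - (if i1 + j1 = 0 \<and> i2 + j2 = 0 then 1 else 0)"
  "laurent_form (laurent_monom s i1 i2) (laurent_monom s j1 j2) = 0"
  by (auto simp: laurent_form_def laurent_monom_def mult_single lookup_single lookup_minus
      when_def add_ac)

end

theory Submission
  imports Defs
begin

text \<open>
  In a perm algebra a product of three elements depends only on its last factor, so each Poisson
  identity on pure tensors splits into three identities in \<open>A\<close>.  Similarly, invariance leaves only two
  independent values of \<open>\<omega>\<close> on products of three elements, and the cyclic sums of the form are
  combinations of these with the defects of the conditions on \<open>A\<close> as coefficients.  In the Laurent
  algebra the triple \<open>x\<^sub>1\<inverse>\<partial>\<^sub>1, \<partial>\<^sub>1, \<partial>\<^sub>2\<close> annihilates one of the two values and not the other, which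
  gives the converse.
\<close>

text \<open>The tensor product is known only through \<open>is_tensor_product\<close>, and its
  operations only as the unique bilinear extensions of their values on pure tensors. Identities are
  therefore phrased as the vanishing of a biadditive or triadditive map, which pure tensors decide.
  Three points escape this scheme. A grading demands unique decompositions of arbitrary tensors; it
  is replaced by a family of linear projections, and those of \<open>B\<close> extend to the tensor
  product by its universal property. Nondegeneracy also concerns arbitrary tensors and calls for a
  basis of \<open>B\<close>. The condition \<open>[x,x] = 0\<close> is quadratic in \<open>x\<close>
  and comes from antisymmetry after division by 2, where characteristic zero enters.

  The Laurent algebra has components of infinite dimension, so it is not an instance of the first
  claim. The construction is carried out for components of any dimension, and finite-dimensionality
  of the components of the tensor product is added separately for the first claim.\<close>

lemma bilinear_map_simps:
  assumes "bilinear_map s1 s2 s3 f"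
  shows "f (x + x') y = f x y + f x' y" "f x (y + y') = f x y + f x y'"
    "f (x - x') y = f x y - f x' y" "f x (y - y') = f x y - f x y'"
    "f (- x) y = - f x y" "f x (- y) = - f x y"
    "f 0 y = 0" "f x 0 = 0"
    "f (s1 c x) y = s3 c (f x y)" "f x (s2 c y) = s3 c (f x y)"
proof -
  interpret L: Vector_Spaces.linear s1 s3 "\<lambda>x. f x y" for y
    using assms unfolding bilinear_map_def by blast
  interpret R: Vector_Spaces.linear s2 s3 "\<lambda>y. f x y" for x
    using assms unfolding bilinear_map_def by blast
  show "f (x + x') y = f x y + f x' y" "f x (y + y') = f x y + f x y'"
    "f (x - x') y = f x y - f x' y" "f x (y - y') = f x y - f x y'"
    "f (- x) y = - f x y" "f x (- y) = - f x y"
    "f 0 y = 0" "f x 0 = 0"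
    "f (s1 c x) y = s3 c (f x y)" "f x (s2 c y) = s3 c (f x y)"
    by (simp_all add: L.add R.add L.diff R.diff L.neg R.neg L.scale R.scale)
qed

lemma bilinear_map_sum_left:
  assumes "bilinear_map s1 s2 s3 f"
  shows "f (sum g S) y = (\<Sum>i\<in>S. f (g i) y)"
  by (induction S rule: infinite_finite_induct) (simp_all add: bilinear_map_simps[OF assms])

lemma bilinear_map_sum_right:
  assumes "bilinear_map s1 s2 s3 f"
  shows "f x (sum g S) = (\<Sum>i\<in>S. f x (g i))"
  by (induction S rule: infinite_finite_induct) (simp_all add: bilinear_map_simps[OF assms])

section \<open>Identities on tensor products\<close>

text \<open>Scalars are absorbed into the first factor and 0 is itself a pure tensor, so every
  tensor is a finite sum of pure ones and the induction has neither a scalar case nor a zero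
  case.\<close>

lemma tensor_induct [consumes 1, case_names tens add]:
  assumes T: "is_tensor_product sA sB sT tens"
    and tens: "\<And>a b. P (tens a b)"
    and add: "\<And>x y. P x \<Longrightarrow> P y \<Longrightarrow> P (x + y)"
  shows "P t"
proof -
  note tb = bilinear_map_simps[OF tensor_bilinear[OF T]]
  from T obtain u where "t = free_extend sT (\<lambda>(a, b). tens a b) u"
    unfolding is_tensor_product_def by (meson surjD)
  then have t: "t = (\<Sum>p\<in>Poly_Mapping.keys u.
      tens (sA (Poly_Mapping.lookup u p) (fst p)) (snd p))"
    by (simp add: free_extend_def split_def tb)
  have "P 0" using tens[of 0 0] by (simp add: tb)
  then have "P (\<Sum>p\<in>S. tens (sA (Poly_Mapping.lookup u p) (fst p)) (snd p))" for S
    by (induction S rule: infinite_finite_induct) (simp_all add: tens add)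
  then show ?thesis by (simp add: t)
qed

text \<open>Since the induction has no scalar case, additivity in each argument suffices; composites
  of the bilinear operations satisfy it by simplification.\<close>

lemma tensor_biadditive_eq_0:
  fixes f :: "'t::ab_group_add \<Rightarrow> 't \<Rightarrow> 'c::ab_group_add"
  assumes T: "is_tensor_product sA sB sT tens"
    and add: "\<And>x x' y. f (x + x') y = f x y + f x' y"
      "\<And>x y y'. f x (y + y') = f x y + f x y'"
    and pure: "\<And>a1 b1 a2 b2. f (tens a1 b1) (tens a2 b2) = 0"
  shows "f x y = 0"
proof (induction x rule: tensor_induct[OF T])
  case (1 a b)
  show ?case by (induction y rule: tensor_induct[OF T]) (simp_all add: add pure)
qed (simp add: add)

lemma tensor_triadditive_eq_0:
  fixes f :: "'t::ab_group_add \<Rightarrow> 't \<Rightarrow> 't \<Rightarrow> 'c::ab_group_add"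
  assumes T: "is_tensor_product sA sB sT tens"
    and add: "\<And>x x' y z. f (x + x') y z = f x y z + f x' y z"
      "\<And>x y y' z. f x (y + y') z = f x y z + f x y' z"
      "\<And>x y z z'. f x y (z + z') = f x y z + f x y z'"
    and pure: "\<And>a1 b1 a2 b2 a3 b3. f (tens a1 b1) (tens a2 b2) (tens a3 b3) = 0"
  shows "f x y z = 0"
proof (induction x rule: tensor_induct[OF T])
  case (1 a b)
  show ?case
    by (rule tensor_biadditive_eq_0[OF T]) (simp_all add: add pure)
qed (simp add: add)

section \<open>The Poisson structure on the tensor product\<close>

lemma tensor_poisson_algebra:
  fixes sT :: "'k::field_char_0 \<Rightarrow> 't::ab_group_add \<Rightarrow> 't"
  assumes A: "pre_poisson_algebra sA ast circ"
    and B: "perm_algebra sB dia"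
    and T: "is_tensor_product sA sB sT tens"
  shows "poisson_algebra sT (tensor_mult sT tens ast dia) (tensor_bracket sT tens circ dia)"
proof -
  have bil: "bilinear_op sA ast" "bilinear_op sA circ" "bilinear_op sB dia"
    using A B unfolding pre_poisson_algebra_def zinbiel_algebra_def pre_lie_algebra_def
      perm_algebra_def by auto
  note [simp] = bilinear_map_simps[OF bil(1)] bilinear_map_simps[OF bil(2)]
    bilinear_map_simps[OF bil(3)]
  note tb = bilinear_map_simps[OF tensor_bilinear[OF T]]
  have perm: "dia x (dia y z) = dia (dia x y) z" "dia (dia x y) z = dia (dia y x) z" for x y z
    using B unfolding perm_algebra_def by auto
  have zin: "ast x (ast y z) = ast (ast x y) z + ast (ast y x) z" for x y z
    using A unfolding pre_poisson_algebra_def zinbiel_algebra_def by auto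
  \<comment> \<open>The identities of \<open>A\<close> are put in the form \<open>... = 0\<close>
    with their terms ordered as in the coefficients below, so that \<open>lie\<close>,
    \<open>pp1\<close> and \<open>pp2\<close> rewrite a whole first tensor factor to 0.\<close>
  have lie: "circ x (circ y z) - circ y (circ x z) - circ (circ x y) z + circ (circ y x) z = 0"
    for x y z
  proof -
    have "circ (circ x y) z - circ x (circ y z) = circ (circ y x) z - circ y (circ x z)"
      using A unfolding pre_poisson_algebra_def pre_lie_algebra_def by blast
    then show ?thesis by (simp add: algebra_simps)
  qed
  have pp1: "circ x (ast y z) - ast (circ x y) z + ast (circ y x) z - ast y (circ x z) = 0"
    for x y z
  proof -
    have "ast (circ x y - circ y x) z = circ x (ast y z) - ast y (circ x z)"
      using A unfolding pre_poisson_algebra_def by blast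
    then show ?thesis by (simp add: algebra_simps)
  qed
  have pp2: "ast x (circ y z) + ast y (circ x z) - circ (ast x y) z - circ (ast y x) z = 0"
    for x y z
  proof -
    have "circ (ast x y + ast y x) z = ast x (circ y z) + ast y (circ x z)"
      using A unfolding pre_poisson_algebra_def by blast
    then show ?thesis by (simp add: algebra_simps)
  qed
  let ?m = "tensor_mult sT tens ast dia" and ?b = "tensor_bracket sT tens circ dia"
  note m = tensor_mult_props[OF T bil(1,3)] and b = tensor_bracket_props[OF T bil(2,3)]
  note [simp] = bilinear_map_simps[OF m(1)] bilinear_map_simps[OF b(1)] m(2) b(2)
  interpret vT: vector_space sT using T unfolding is_tensor_product_def by blast
  have comm: "?m x y = ?m y x" for x y
  proof -
    have "?m x y - ?m y x = 0"
      by (rule tensor_biadditive_eq_0[OF T, where f = "\<lambda>x y. ?m x y - ?m y x"])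
        (simp_all add: algebra_simps)
    then show ?thesis by simp
  qed
  \<comment> \<open>\<open>zin\<close> and the first half of \<open>perm\<close> nest all triple
    products to the left; the second half is an ordered rewrite rule, so both sides reach the same
    normal form.\<close>
  have assoc: "?m (?m x y) z = ?m x (?m y z)" for x y z
  proof -
    have "?m (?m x y) z - ?m x (?m y z) = 0"
      by (rule tensor_triadditive_eq_0[OF T, where f = "\<lambda>x y z. ?m (?m x y) z - ?m x (?m y z)"])
        (simp_all add: algebra_simps perm zin tb)
    then show ?thesis by simp
  qed
  have skew: "?b x x = 0" for x
  proof -
    \<comment> \<open>The biadditive map \<open>[x,y] + [y,x]\<close> vanishes on pure tensors,
      hence everywhere, in particular on the diagonal.\<close>
    have "?b x x + ?b x x = 0"
      by (rule tensor_biadditive_eq_0[OF T, where f = "\<lambda>x y. ?b x y + ?b y x"])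
        (simp_all add: algebra_simps)
    then have "sT 2 (?b x x) = 0"
      using vT.scale_left_distrib[of 1 1 "?b x x"] by simp
    then show ?thesis by simp
  qed
  have jacobi: "?b x (?b y z) + ?b y (?b z x) + ?b z (?b x y) = 0" for x y z
  proof (rule tensor_triadditive_eq_0[OF T,
        where f = "\<lambda>x y z. ?b x (?b y z) + ?b y (?b z x) + ?b z (?b x y)"])
    fix a1 b1 a2 b2 a3 b3
    \<comment> \<open>Of the twelve terms of the expansion, four belong to each last factor
      \<open>b3\<close>, \<open>b1\<close>, \<open>b2\<close>; they form the pre-Lie identity for a
      cyclic shift of the arguments.\<close>
    have "?b (tens a1 b1) (?b (tens a2 b2) (tens a3 b3)) + ?b (tens a2 b2) (?b (tens a3 b3) (tens a1 b1))
        + ?b (tens a3 b3) (?b (tens a1 b1) (tens a2 b2)) =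
      tens (circ a1 (circ a2 a3) - circ a2 (circ a1 a3) - circ (circ a1 a2) a3 + circ (circ a2 a1) a3)
        (dia (dia b1 b2) b3) +
      tens (circ a2 (circ a3 a1) - circ a3 (circ a2 a1) - circ (circ a2 a3) a1 + circ (circ a3 a2) a1)
        (dia (dia b2 b3) b1) +
      tens (circ a3 (circ a1 a2) - circ a1 (circ a3 a2) - circ (circ a3 a1) a2 + circ (circ a1 a3) a2)
        (dia (dia b3 b1) b2)"
      by (simp only: b(2) bilinear_map_simps[OF b(1)] tb) (simp add: perm algebra_simps)
    then show "?b (tens a1 b1) (?b (tens a2 b2) (tens a3 b3)) +
        ?b (tens a2 b2) (?b (tens a3 b3) (tens a1 b1)) +
        ?b (tens a3 b3) (?b (tens a1 b1) (tens a2 b2)) = 0"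
      by (simp only: lie tb add_0)
  qed (simp_all add: algebra_simps)
  have leibniz: "?b x (?m y z) = ?m (?b x y) z + ?m y (?b x z)" for x y z
  proof -
    have "?b x (?m y z) - ?m (?b x y) z - ?m y (?b x z) = 0"
    proof (rule tensor_triadditive_eq_0[OF T,
          where f = "\<lambda>x y z. ?b x (?m y z) - ?m (?b x y) z - ?m y (?b x z)"])
      fix a1 b1 a2 b2 a3 b3
      \<comment> \<open>The last factors \<open>b3\<close> and \<open>b2\<close> collect instances
        of \<open>pp1\<close>, the last factor \<open>b1\<close> an instance of
        \<open>pp2\<close>.\<close>
      have "?b (tens a1 b1) (?m (tens a2 b2) (tens a3 b3)) - ?m (?b (tens a1 b1) (tens a2 b2)) (tens a3 b3)
          - ?m (tens a2 b2) (?b (tens a1 b1) (tens a3 b3)) =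
        tens (circ a1 (ast a2 a3) - ast (circ a1 a2) a3 + ast (circ a2 a1) a3 - ast a2 (circ a1 a3))
          (dia (dia b1 b2) b3) +
        tens (circ a1 (ast a3 a2) - ast (circ a1 a3) a2 + ast (circ a3 a1) a2 - ast a3 (circ a1 a2))
          (dia (dia b1 b3) b2) +
        tens (ast a2 (circ a3 a1) + ast a3 (circ a2 a1) - circ (ast a2 a3) a1 - circ (ast a3 a2) a1)
          (dia (dia b2 b3) b1)"
        by (simp only: b(2) m(2) bilinear_map_simps[OF b(1)] bilinear_map_simps[OF m(1)] tb)
          (simp add: perm algebra_simps)
      then show "?b (tens a1 b1) (?m (tens a2 b2) (tens a3 b3)) -
          ?m (?b (tens a1 b1) (tens a2 b2)) (tens a3 b3) -
          ?m (tens a2 b2) (?b (tens a1 b1) (tens a3 b3)) = 0"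
        by (simp only: pp1 pp2 tb add_0)
    qed (simp_all add: algebra_simps)
    then show ?thesis by (simp add: algebra_simps)
  qed
  show ?thesis
    unfolding poisson_algebra_def using m(1) b(1) comm assoc skew jacobi leibniz by blast
qed

section \<open>Gradings\<close>

text \<open>Linear maps pass through a tensor product by its universal property, whereas the unique
  existence in \<open>int_grading\<close> does not transfer directly.\<close>

definition grading_projections ::
    "('k::field \<Rightarrow> 'v::ab_group_add \<Rightarrow> 'v) \<Rightarrow> (int \<Rightarrow> 'v set) \<Rightarrow> (int \<Rightarrow> 'v \<Rightarrow> 'v) \<Rightarrow> bool" where
  "grading_projections s G P \<longleftrightarrow>
     (\<forall>i. Vector_Spaces.linear s s (P i)) \<and>
     (\<forall>i j x. x \<in> G j \<longrightarrow> P i x = (if i = j then x else 0)) \<and>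
     (\<forall>x. (\<forall>i. P i x \<in> G i) \<and> finite {i. P i x \<noteq> 0} \<and> x = (\<Sum>i | P i x \<noteq> 0. P i x))"

text \<open>Cancellation may make the support of a sum smaller than the union of the supports, so
  all sums are first extended to that union.\<close>

lemma sum_components_add:
  fixes c d :: "int \<Rightarrow> 'v::ab_group_add"
  assumes "finite {i. c i \<noteq> 0}" "finite {i. d i \<noteq> 0}"
  shows "finite {i. c i + d i \<noteq> 0}"
    and "(\<Sum>i | c i + d i \<noteq> 0. c i + d i) = (\<Sum>i | c i \<noteq> 0. c i) + (\<Sum>i | d i \<noteq> 0. d i)"
proof -
  let ?S = "{i. c i \<noteq> 0} \<union> {i. d i \<noteq> 0}"
  have fin: "finite ?S" using assms by simp
  have sub: "{i. c i + d i \<noteq> 0} \<subseteq> ?S" by auto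
  show "finite {i. c i + d i \<noteq> 0}" by (rule finite_subset[OF sub fin])
  have "(\<Sum>i | c i + d i \<noteq> 0. c i + d i) = (\<Sum>i\<in>?S. c i + d i)"
    using fin sub by (intro sum.mono_neutral_left) auto
  moreover have "(\<Sum>i | c i \<noteq> 0. c i) = (\<Sum>i\<in>?S. c i)"
    using fin by (intro sum.mono_neutral_left) auto
  moreover have "(\<Sum>i | d i \<noteq> 0. d i) = (\<Sum>i\<in>?S. d i)"
    using fin by (intro sum.mono_neutral_left) auto
  ultimately show "(\<Sum>i | c i + d i \<noteq> 0. c i + d i) = (\<Sum>i | c i \<noteq> 0. c i) + (\<Sum>i | d i \<noteq> 0. d i)"
    by (simp add: sum.distrib)
qed

text \<open>Linearity is a consequence of uniqueness: adding or scaling decompositions componentwise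
  gives a decomposition of the sum or multiple, hence the decomposition.\<close>

lemma int_grading_projections:
  assumes G: "int_grading s G"
  obtains P where "grading_projections s G P"
proof -
  let ?D = "\<lambda>x c. (\<forall>i. c i \<in> G i) \<and> finite {i. c i \<noteq> 0} \<and> x = (\<Sum>i | c i \<noteq> 0. c i)"
  interpret vector_space s using G unfolding int_grading_def by blast
  have sub: "subspace (G i)" for i using G unfolding int_grading_def by blast
  have ex: "\<exists>!c. ?D x c" for x
    using G unfolding int_grading_def by blast
  define Q where "Q x = (THE c. ?D x c)" for x
  have Q: "?D x (Q x)" for x unfolding Q_def by (rule theI'[OF ex])
  have eq: "Q x = c" if "?D x c" for x c using ex[of x] Q[of x] that by blast
  have add: "Q (x + y) = (\<lambda>i. Q x i + Q y i)" for x y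
  proof (rule eq, intro conjI allI)
    fix i show "Q x i + Q y i \<in> G i" using Q subspace_add[OF sub] by blast
  next
    show "finite {i. Q x i + Q y i \<noteq> 0}"
      by (rule sum_components_add) (use Q in blast)+
    have "(\<Sum>i | Q x i + Q y i \<noteq> 0. Q x i + Q y i) =
        (\<Sum>i | Q x i \<noteq> 0. Q x i) + (\<Sum>i | Q y i \<noteq> 0. Q y i)"
      by (rule sum_components_add) (use Q in blast)+
    then show "x + y = (\<Sum>i | Q x i + Q y i \<noteq> 0. Q x i + Q y i)"
      using Q[of x] Q[of y] by simp
  qed
  have scale: "Q (s c x) = (\<lambda>i. s c (Q x i))" for c x
  proof (rule eq, intro conjI allI)
    fix i show "s c (Q x i) \<in> G i" using Q subspace_scale[OF sub] by blast
  next
    show "finite {i. s c (Q x i) \<noteq> 0}"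
      by (rule finite_subset[of _ "{i. Q x i \<noteq> 0}"]) (use Q in auto)
    have "x = (\<Sum>i | Q x i \<noteq> 0. Q x i)" using Q by blast
    then have "s c x = (\<Sum>i | Q x i \<noteq> 0. s c (Q x i))" by (metis scale_sum_right)
    also have "\<dots> = (\<Sum>i | s c (Q x i) \<noteq> 0. s c (Q x i))"
      using Q[of x] by (intro sum.mono_neutral_right) auto
    finally show "s c x = (\<Sum>i | s c (Q x i) \<noteq> 0. s c (Q x i))" .
  qed
  have hom: "Q x = (\<lambda>i. if i = j then x else 0)" if "x \<in> G j" for x j
  proof (rule eq, intro conjI allI)
    show "(if i = j then x else 0) \<in> G i" for i using that subspace_0[OF sub] by simp
    \<comment> \<open>For \<open>x = 0\<close> the support is empty, not \<open>{j}\<close>.\<close>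
    have "{i. (if i = j then x else 0) \<noteq> 0} = (if x = 0 then {} else {j})" by auto
    then show "finite {i. (if i = j then x else 0) \<noteq> 0}"
      "x = (\<Sum>i | (if i = j then x else 0) \<noteq> 0. if i = j then x else 0)" by simp_all
  qed
  have "grading_projections s G (\<lambda>i x. Q x i)"
    unfolding grading_projections_def Vector_Spaces.linear_iff
    using vector_space_axioms Q by (auto simp: add scale hom)
  then show ?thesis by (rule that)
qed

text \<open>Applying \<open>P i\<close> to any decomposition leaves only its component in degree
  \<open>i\<close>, which gives uniqueness.\<close>

lemma int_gradingI:
  assumes sub: "\<And>i. module.subspace s (G i)" and P: "grading_projections s G P"
  shows "int_grading s G"
proof -
  interpret P: Vector_Spaces.linear s s "P i" for i
    using P unfolding grading_projections_def by blast
  have hom: "P i x = (if i = j then x else 0)" if "x \<in> G j" for i j x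
    using P that unfolding grading_projections_def by blast
  have "c = (\<lambda>i. P i x)"
    if c: "\<forall>i. c i \<in> G i" "finite {i. c i \<noteq> 0}" "x = (\<Sum>i | c i \<noteq> 0. c i)" for x c
  proof
    fix i
    have "P i x = (\<Sum>j | c j \<noteq> 0. P i (c j))" by (simp add: c(3) P.sum)
    also have "\<dots> = (\<Sum>j | c j \<noteq> 0. if i = j then c j else 0)"
      using c(1) by (intro sum.cong refl hom) blast
    also have "\<dots> = c i" using c(2) by simp
    finally show "c i = P i x" by simp
  qed
  moreover have "(\<forall>i. P i x \<in> G i) \<and> finite {i. P i x \<noteq> 0} \<and> x = (\<Sum>i | P i x \<noteq> 0. P i x)" for x
    using P unfolding grading_projections_def by blast
  ultimately show ?thesis
    unfolding int_grading_def using sub P.vs1.vector_space_axioms by metis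
qed

text \<open>The projections of the tensor product are the maps \<open>id \<otimes> \<pi> i\<close>,
  obtained from the universal property.\<close>

lemma tensor_int_grading:
  assumes G: "int_grading sB G" and T: "is_tensor_product sA sB sT tens"
  shows "int_grading sT (tensor_grading sT tens G)"
proof -
  obtain \<pi> where \<pi>: "grading_projections sB G \<pi>" by (rule int_grading_projections[OF G])
  note tb = bilinear_map_simps[OF tensor_bilinear[OF T]]
  interpret T: vector_space sT using T unfolding is_tensor_product_def by blast
  have l\<pi>: "Vector_Spaces.linear sB sB (\<pi> i)" for i
    using \<pi> unfolding grading_projections_def by blast
  have hom: "\<pi> i x = (if i = j then x else 0)" if "x \<in> G j" for i j x
    using \<pi> that unfolding grading_projections_def by blast
  have dec: "\<pi> i x \<in> G i" "finite {i. \<pi> i x \<noteq> 0}" "(\<Sum>i | \<pi> i x \<noteq> 0. \<pi> i x) = x" for i x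
    using \<pi> unfolding grading_projections_def by auto
  have "bilinear_map sA sB sT (\<lambda>a b. tens a (\<pi> i b))" for i
    using T l\<pi>[of i] unfolding bilinear_map_def Vector_Spaces.linear_iff is_tensor_product_def
    by (simp add: tb)
  then have "\<exists>g. Vector_Spaces.linear sT sT g \<and> (\<forall>a b. g (tens a b) = tens a (\<pi> i b))" for i
    using tensor_universal[OF T] by blast
  then obtain P where lP: "\<And>i. Vector_Spaces.linear sT sT (P i)"
    and Pt: "\<And>i a b. P i (tens a b) = tens a (\<pi> i b)" by metis
  interpret P: Vector_Spaces.linear sT sT "P i" for i by (rule lP)
  let ?G = "tensor_grading sT tens G"
  have Pin: "P i x \<in> ?G i" for i x
  proof (induction x rule: tensor_induct[OF T])
    case (1 a b)
    show ?case unfolding Pt tensor_grading_def using dec(1) by (intro T.span_base) blast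
  next
    case (2 x y)
    then show ?case unfolding P.add tensor_grading_def by (rule T.span_add)
  qed
  have dec_T: "finite {i. P i x \<noteq> 0} \<and> x = (\<Sum>i | P i x \<noteq> 0. P i x)" for x
  proof (induction x rule: tensor_induct[OF T])
    case (1 a b)
    have sub: "{i. P i (tens a b) \<noteq> 0} \<subseteq> {i. \<pi> i b \<noteq> 0}" by (auto simp: Pt tb)
    have "tens a b = (\<Sum>i | \<pi> i b \<noteq> 0. P i (tens a b))"
      unfolding Pt bilinear_map_sum_right[OF tensor_bilinear[OF T], symmetric] dec(3) ..
    also have "\<dots> = (\<Sum>i | P i (tens a b) \<noteq> 0. P i (tens a b))"
      using sub dec(2)[of b] by (intro sum.mono_neutral_right) auto
    finally show ?case using finite_subset[OF sub dec(2)] by simp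
  next
    case (2 x y)
    then show ?case
      using sum_components_add[of "\<lambda>i. P i x" "\<lambda>i. P i y"] by (simp add: P.add)
  qed
  have "P i x = (if i = j then x else 0)" if "x \<in> ?G j" for i j x
    using that unfolding tensor_grading_def
    by (induction rule: T.span_induct_alt) (auto simp: P.add P.scale Pt hom tb)
  then have "grading_projections sT ?G P"
    unfolding grading_projections_def using lP Pin dec_T by blast
  then show ?thesis
    by (intro int_gradingI) (simp_all add: tensor_grading_def T.subspace_span)
qed

text \<open>The scalar of a linear combination goes into the \<open>A\<close> factor, so the
  \<open>B\<close> factor remains the given element of \<open>G i\<close>.\<close>

lemma tensor_grading_induct:
  assumes T: "is_tensor_product sA sB sT tens" and sub: "module.subspace sB (G i)"
    and x: "x \<in> tensor_grading sT tens G i"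
    and tens: "\<And>a b. b \<in> G i \<Longrightarrow> R (tens a b)"
    and add: "\<And>x y. R x \<Longrightarrow> R y \<Longrightarrow> R (x + y)"
  shows "R x"
proof -
  interpret T: vector_space sT using T unfolding is_tensor_product_def by blast
  interpret B: vector_space sB using T unfolding is_tensor_product_def by blast
  note tb = bilinear_map_simps[OF tensor_bilinear[OF T]]
  show ?thesis using x unfolding tensor_grading_def
  proof (induction rule: T.span_induct_alt)
    case base
    show ?case using tens[of 0 0] B.subspace_0[OF sub] by (simp add: tb)
  next
    case (step c x y)
    then obtain a b where "x = tens a b" "b \<in> G i" by blast
    then show ?case using tens[of b "sA c a"] step.IH by (auto simp: tb intro: add)
  qed
qed

lemma tensor_graded_op:
  assumes T: "is_tensor_product sA sB sT tens" and G: "int_grading sB G"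
    and bil: "bilinear_op sT m"
    and pure: "\<And>i j a1 b1 a2 b2. b1 \<in> G i \<Longrightarrow> b2 \<in> G j \<Longrightarrow>
      m (tens a1 b1) (tens a2 b2) \<in> tensor_grading sT tens G (i + j)"
  shows "graded_op (tensor_grading sT tens G) m"
  unfolding graded_op_def
proof (intro allI ballI)
  fix i j x y
  assume x: "x \<in> tensor_grading sT tens G i" and y: "y \<in> tensor_grading sT tens G j"
  interpret T: vector_space sT using T unfolding is_tensor_product_def by blast
  have sub: "module.subspace sB (G i)" for i using G unfolding int_grading_def by blast
  let ?H = "tensor_grading sT tens G (i + j)"
  have H: "u + v \<in> ?H" if "u \<in> ?H" "v \<in> ?H" for u v
    using that unfolding tensor_grading_def by (rule T.span_add)
  show "m x y \<in> ?H"
  proof (rule tensor_grading_induct[OF T sub x])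
    fix a b assume b: "b \<in> G i"
    show "m (tens a b) y \<in> ?H"
      by (rule tensor_grading_induct[OF T sub y])
        (simp_all add: pure[OF b] bilinear_map_simps[OF bil] H)
  qed (simp add: bilinear_map_simps[OF bil] H)
qed

lemma tensor_graded_form:
  assumes T: "is_tensor_product sA sB sT tens" and G: "int_grading sB G"
    and \<beta>: "bilinear_form sA \<beta>" and \<omega>: "bilinear_form sB \<omega>" "graded_form G \<omega>"
  shows "graded_form (tensor_grading sT tens G) (tensor_form sT tens \<beta> \<omega>)"
proof -
  from \<omega>(2) obtain m where m: "\<And>i j x y. i + j + m \<noteq> 0 \<Longrightarrow> x \<in> G i \<Longrightarrow> y \<in> G j \<Longrightarrow> \<omega> x y = 0"
    unfolding graded_form_def by blast
  let ?F = "tensor_form sT tens \<beta> \<omega>"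
  note F = tensor_form_props[OF T \<beta> \<omega>(1)]
  have sub: "module.subspace sB (G i)" for i using G unfolding int_grading_def by blast
  have "?F x y = 0"
    if ij: "i + j + m \<noteq> 0" and x: "x \<in> tensor_grading sT tens G i"
      and y: "y \<in> tensor_grading sT tens G j" for i j x y
  proof (rule tensor_grading_induct[OF T sub x])
    fix a b assume b: "b \<in> G i"
    show "?F (tens a b) y = 0"
      by (rule tensor_grading_induct[OF T sub y])
        (simp_all add: F(2) m[OF ij b] bilinear_map_simps[OF F(1)])
  qed (simp add: bilinear_map_simps[OF F(1)])
  then show ?thesis unfolding graded_form_def by blast
qed

text \<open>Products of a finite spanning set of \<open>A\<close> with one of \<open>G i\<close>
  span the component; the two factors are expanded one after the other.\<close>

lemma tensor_fin_dim_components: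
  assumes A: "fin_dim sA UNIV" and B: "fin_dim_components sB G"
    and T: "is_tensor_product sA sB sT tens"
  shows "fin_dim_components sT (tensor_grading sT tens G)"
  unfolding fin_dim_components_def
proof
  fix i
  interpret T: vector_space sT using T unfolding is_tensor_product_def by blast
  interpret A: vector_space sA using T unfolding is_tensor_product_def by blast
  interpret B: vector_space sB using T unfolding is_tensor_product_def by blast
  note tb = bilinear_map_simps[OF tensor_bilinear[OF T]]
  obtain S where S: "finite S" "A.span S = UNIV" using A unfolding fin_dim_def by blast
  obtain R where R: "finite R" "B.span R = G i"
    using B unfolding fin_dim_components_def fin_dim_def by blast
  let ?K = "(\<lambda>(a, b). tens a b) ` (S \<times> R)"
  have 1: "tens a b \<in> T.span ?K" if "a \<in> S" "b \<in> B.span R" for a b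
    using that(2)
    by (induction rule: B.span_induct_alt)
      (use that(1) in \<open>auto simp: tb T.span_zero intro!: T.span_add T.span_scale intro: T.span_base\<close>)
  have 2: "tens a b \<in> T.span ?K" if b: "b \<in> G i" for a b
  proof -
    have "a \<in> A.span S" using S by simp
    then show ?thesis
      by (induction rule: A.span_induct_alt)
        (use b R in \<open>auto simp: tb T.span_zero intro!: T.span_add T.span_scale 1\<close>)
  qed
  have "T.span ?K = tensor_grading sT tens G i"
    unfolding tensor_grading_def
  proof (rule T.span_eq[THEN iffD2], intro conjI)
    show "?K \<subseteq> T.span {tens a b | a b. b \<in> G i}"
      using R(2) B.span_superset[of R] by (auto intro!: T.span_base)
    show "{tens a b | a b. b \<in> G i} \<subseteq> T.span ?K" using 2 by blast
  qed
  then show "fin_dim sT (tensor_grading sT tens G i)"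
    unfolding fin_dim_def using S(1) R(1) by (intro exI[of _ ?K]) simp
qed

section \<open>Forms on tensor products\<close>

text \<open>Collecting terms by elements of \<open>K\<close> moves all coefficients into
  \<open>A\<close>, where \<open>\<beta>\<close> can test them.\<close>

lemma tensor_basis_expansion:
  assumes T: "is_tensor_product sA sB sT tens"
    and K: "module.span sB K = UNIV"
  obtains S c where "finite S" "S \<subseteq> K" "t = (\<Sum>b\<in>S. tens (c b) b)"
proof -
  interpret A: vector_space sA using T unfolding is_tensor_product_def by blast
  interpret B: vector_space sB using T unfolding is_tensor_product_def by blast
  note tb = bilinear_map_simps[OF tensor_bilinear[OF T]]
  have "\<exists>S c. finite S \<and> S \<subseteq> K \<and> t = (\<Sum>b\<in>S. tens (c b) b)"
  proof (induction t rule: tensor_induct[OF T])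
    case (1 a b)
    have "b \<in> B.span K" using K by simp
    then obtain S r where "finite S" "S \<subseteq> K" "b = (\<Sum>v\<in>S. sB (r v) v)"
      unfolding B.span_explicit by auto
    then have "tens a b = (\<Sum>v\<in>S. tens (sA (r v) a) v)"
      by (simp add: tb bilinear_map_sum_right[OF tensor_bilinear[OF T]])
    with \<open>finite S\<close> \<open>S \<subseteq> K\<close> show ?case
      by (intro exI[of _ S] exI[of _ "\<lambda>v. sA (r v) a"] conjI)
  next
    case (2 x y)
    from 2(1) obtain S c where S: "finite S" "S \<subseteq> K" "x = (\<Sum>b\<in>S. tens (c b) b)"
      by (elim exE conjE)
    from 2(2) obtain R d where R: "finite R" "R \<subseteq> K" "y = (\<Sum>b\<in>R. tens (d b) b)"
      by (elim exE conjE)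
    \<comment> \<open>Coefficients are extended by 0 so that both sums run over the same index
      set.\<close>
    have "x = (\<Sum>b\<in>S \<union> R. tens (if b \<in> S then c b else 0) b)"
      unfolding S(3) using S(1) R(1) by (intro sum.mono_neutral_cong_left) (auto simp: tb)
    moreover have "y = (\<Sum>b\<in>S \<union> R. tens (if b \<in> R then d b else 0) b)"
      unfolding R(3) using S(1) R(1) by (intro sum.mono_neutral_cong_left) (auto simp: tb)
    ultimately have "x + y = (\<Sum>b\<in>S \<union> R.
        tens ((if b \<in> S then c b else 0) + (if b \<in> R then d b else 0)) b)"
      by (simp only: tb sum.distrib)
    then show ?case
      using S(1,2) R(1,2)
      by (intro exI[of _ "S \<union> R"]
          exI[of _ "\<lambda>b. (if b \<in> S then c b else 0) + (if b \<in> R then d b else 0)"]) simp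
  qed
  then show ?thesis using that by blast
qed

lemma tensor_form_antisymmetric:
  assumes T: "is_tensor_product sA sB sT tens"
    and \<beta>: "bilinear_form sA \<beta>" "symmetric_form \<beta>"
    and \<omega>: "bilinear_form sB \<omega>" "antisymmetric_form \<omega>"
  shows "antisymmetric_form (tensor_form sT tens \<beta> \<omega>)"
proof -
  let ?F = "tensor_form sT tens \<beta> \<omega>"
  note F = tensor_form_props[OF T \<beta>(1) \<omega>(1)]
  have "?F x y + ?F y x = 0" for x y
  proof (rule tensor_biadditive_eq_0[OF T, where f = "\<lambda>x y. ?F x y + ?F y x"])
    fix a1 b1 a2 b2
    have "\<beta> a2 a1 = \<beta> a1 a2" using \<beta>(2) unfolding symmetric_form_def by blast
    moreover have "\<omega> b2 b1 = - \<omega> b1 b2" using \<omega>(2) unfolding antisymmetric_form_def by blast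
    ultimately show "?F (tens a1 b1) (tens a2 b2) + ?F (tens a2 b2) (tens a1 b1) = 0"
      by (simp add: F(2))
  qed (simp_all add: bilinear_map_simps[OF F(1)] algebra_simps)
  then show ?thesis unfolding antisymmetric_form_def by (simp add: eq_neg_iff_add_eq_0)
qed

text \<open>
  Expanding \<open>t\<close> as \<open>\<Sum>\<^sub>b tens (c b) b\<close> over a basis of \<open>B\<close>, nondegeneracy of \<open>\<omega>\<close> and independence of
  the \<open>b\<close> reduce the claim to nondegeneracy of \<open>\<beta>\<close>.
\<close>

lemma tensor_form_nondegenerate_left:
  assumes T: "is_tensor_product sA sB sT tens"
    and \<beta>: "bilinear_form sA \<beta>" "nondegenerate_form \<beta>"
    and \<omega>: "bilinear_form sB \<omega>" "nondegenerate_form \<omega>"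
    and t: "\<And>y. tensor_form sT tens \<beta> \<omega> t y = 0"
  shows "t = 0"
proof -
  interpret B: vector_space sB using T unfolding is_tensor_product_def by blast
  let ?F = "tensor_form sT tens \<beta> \<omega>"
  note F = tensor_form_props[OF T \<beta>(1) \<omega>(1)]
  obtain K where K: "B.independent K" "B.span K = UNIV"
    by (metis B.maximal_independent_subset top.extremum_uniqueI)
  obtain S c where S: "finite S" "S \<subseteq> K" and tS: "t = (\<Sum>b\<in>S. tens (c b) b)"
    by (rule tensor_basis_expansion[OF T K(2)])
  have "\<beta> (c b) a = 0" if b: "b \<in> S" for a b
  proof -
    have "\<omega> (\<Sum>v\<in>S. sB (\<beta> (c v) a) v) y = 0" for y
    proof -
      \<comment> \<open>Fixing \<open>a\<close> and varying \<open>y\<close> separates the two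
        forms: the values of \<open>\<beta>\<close> become scalars that move inside
        \<open>\<omega>\<close>.\<close>
      have "0 = ?F t (tens a y)" by (simp add: t)
      also have "\<dots> = (\<Sum>v\<in>S. \<beta> (c v) a * \<omega> v y)"
        by (simp add: tS bilinear_map_sum_left[OF F(1)] F(2))
      also have "\<dots> = \<omega> (\<Sum>v\<in>S. sB (\<beta> (c v) a) v) y"
        by (simp add: bilinear_map_sum_left[OF \<omega>(1)] bilinear_map_simps[OF \<omega>(1)])
      finally show ?thesis by simp
    qed
    then have "(\<Sum>v\<in>S. sB (\<beta> (c v) a) v) = 0"
      using \<omega>(2) unfolding nondegenerate_form_def by blast
    then show ?thesis using B.independentD[OF K(1) S, of "\<lambda>v. \<beta> (c v) a"] b by simp
  qed
  then have "c b = 0" if "b \<in> S" for b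
    using \<beta>(2) that unfolding nondegenerate_form_def by blast
  then show ?thesis
    by (simp add: tS bilinear_map_simps[OF tensor_bilinear[OF T]])
qed

lemma antisymmetric_nondegenerateI:
  fixes F :: "'v::zero \<Rightarrow> 'v \<Rightarrow> 'k::group_add"
  assumes "antisymmetric_form F" "\<And>x. (\<And>y. F x y = 0) \<Longrightarrow> x = 0"
  shows "nondegenerate_form F"
proof -
  have "F x y = 0 \<longleftrightarrow> F y x = 0" for x y
  proof -
    have "F x y = - F y x" using assms(1) unfolding antisymmetric_form_def by blast
    then show ?thesis by (simp only: neg_equal_0_iff_equal)
  qed
  then show ?thesis unfolding nondegenerate_form_def using assms(2) by blast
qed

section \<open>Cyclic sums and both directions of the equivalence\<close>

text \<open>This covers the Laurent algebra as well, whose components have infinite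
  dimension.\<close>

definition quadratic_graded_perm_algebra_any_dim ::
    "('k::field \<Rightarrow> 'b::ab_group_add \<Rightarrow> 'b) \<Rightarrow> (int \<Rightarrow> 'b set) \<Rightarrow> ('b \<Rightarrow> 'b \<Rightarrow> 'b) \<Rightarrow>
     ('b \<Rightarrow> 'b \<Rightarrow> 'k) \<Rightarrow> bool" where
  "quadratic_graded_perm_algebra_any_dim s G dia \<omega> \<longleftrightarrow>
     perm_algebra s dia \<and> int_grading s G \<and> graded_op G dia \<and>
     bilinear_form s \<omega> \<and> antisymmetric_form \<omega> \<and> nondegenerate_form \<omega> \<and> graded_form G \<omega> \<and>
     (\<forall>x y z. \<omega> (dia x y) z = \<omega> x (dia y z - dia z y))"

lemma perm_form_values:
  assumes "bilinear_form sB \<omega>" "antisymmetric_form \<omega>"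
    and "\<And>x y z. \<omega> (dia x y) z = \<omega> x (dia y z - dia z y)"
  shows "\<omega> (dia x y) z = \<omega> x (dia y z) - \<omega> x (dia z y)"
    "\<omega> (dia y x) z = \<omega> x (dia y z)"
    "\<omega> (dia y z) x = - \<omega> x (dia y z)"
    "\<omega> (dia z y) x = - \<omega> x (dia z y)"
    "\<omega> (dia z x) y = \<omega> x (dia z y)"
    "\<omega> (dia x z) y = \<omega> x (dia z y) - \<omega> x (dia y z)"
proof -
  note inv = assms(3)[unfolded bilinear_map_simps(4)[OF assms(1)]]
  have anti: "\<omega> u v = - \<omega> v u" for u v
    using assms(2) unfolding antisymmetric_form_def by blast
  show "\<omega> (dia x y) z = \<omega> x (dia y z) - \<omega> x (dia z y)"
    "\<omega> (dia x z) y = \<omega> x (dia z y) - \<omega> x (dia y z)"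
    by (rule inv)+
  show yz: "\<omega> (dia y z) x = - \<omega> x (dia y z)" "\<omega> (dia z y) x = - \<omega> x (dia z y)"
    by (rule anti)+
  \<comment> \<open>Left multiplications are self-adjoint: in the invariance law for
    \<open>y, z, x\<close>, antisymmetry and the law for \<open>x, z, y\<close> rewrite the other
    terms, and \<open>\<omega> x (dia y z)\<close> cancels.\<close>
  have 1: "\<omega> (dia z x) y = \<omega> x (dia z y)" for x y z
    using inv[of y z x] anti[of y "dia z x"] anti[of y "dia x z"] inv[of x z y]
      anti[of "dia y z" x] by (simp add: algebra_simps)
  show "\<omega> (dia y x) z = \<omega> x (dia y z)" "\<omega> (dia z x) y = \<omega> x (dia z y)"
    by (rule 1)+
qed

text \<open>An exact formula serves both directions: if the defects \<open>z\<close> and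
  \<open>l\<close> vanish, so do the cyclic sums, and if the cyclic sums vanish, suitable
  \<open>b1\<close>, \<open>b2\<close>, \<open>b3\<close> recover the defects.\<close>

lemma tensor_cyclic_sums:
  assumes T: "is_tensor_product sA sB sT tens"
    and bil: "bilinear_op sA ast" "bilinear_op sA circ" "bilinear_op sB dia"
    and \<beta>: "bilinear_form sA \<beta>" "symmetric_form \<beta>"
    and \<omega>: "bilinear_form sB \<omega>" "antisymmetric_form \<omega>"
      "\<And>x y z. \<omega> (dia x y) z = \<omega> x (dia y z - dia z y)"
  defines "F \<equiv> tensor_form sT tens \<beta> \<omega>"
    and "m \<equiv> tensor_mult sT tens ast dia" and "b \<equiv> tensor_bracket sT tens circ dia"
    and "z \<equiv> \<lambda>x y z. \<beta> (ast x y + ast y x) z - \<beta> x (ast y z) - \<beta> y (ast x z)"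
    and "l \<equiv> \<lambda>x y z. (\<beta> (circ x y) z - \<beta> x (circ y z)) - (\<beta> (circ y x) z - \<beta> y (circ x z))"
  shows
    "F (m (tens a1 b1) (tens a2 b2)) (tens a3 b3) + F (m (tens a2 b2) (tens a3 b3)) (tens a1 b1) +
      F (m (tens a3 b3) (tens a1 b1)) (tens a2 b2) =
      \<omega> b1 (dia b2 b3) * z a1 a2 a3 + \<omega> b1 (dia b3 b2) * z a3 a1 a2"
    "F (b (tens a1 b1) (tens a2 b2)) (tens a3 b3) + F (b (tens a2 b2) (tens a3 b3)) (tens a1 b1) +
      F (b (tens a3 b3) (tens a1 b1)) (tens a2 b2) =
      \<omega> b1 (dia b2 b3) * l a1 a2 a3 + \<omega> b1 (dia b3 b2) * l a3 a1 a2"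
proof -
  \<comment> \<open>The function \<open>f\<close> is later instantiated by a multiplication, so that
    rewriting moves every product into the first slot and cannot loop.\<close>
  have sym: "\<beta> x (f y) = \<beta> (f y) x" for x y and f :: "'b \<Rightarrow> 'b"
    using \<beta>(2) unfolding symmetric_form_def by blast
  note simps = F_def m_def b_def z_def l_def
    tensor_mult_props(2)[OF T bil(1,3)] tensor_bracket_props(2)[OF T bil(2,3)]
    tensor_form_props(2)[OF T \<beta>(1) \<omega>(1)]
    bilinear_map_simps(1,3)[OF tensor_form_props(1)[OF T \<beta>(1) \<omega>(1)]]
    bilinear_map_simps(1)[OF \<beta>(1)]
    sym[of a1 "ast _"] sym[of a2 "ast _"] sym[of a3 "ast _"]
    sym[of a1 "circ _"] sym[of a2 "circ _"] sym[of a3 "circ _"]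
    perm_form_values[OF \<omega>, where x = b1 and y = b2 and z = b3]
  show "F (m (tens a1 b1) (tens a2 b2)) (tens a3 b3) + F (m (tens a2 b2) (tens a3 b3)) (tens a1 b1) +
      F (m (tens a3 b3) (tens a1 b1)) (tens a2 b2) =
      \<omega> b1 (dia b2 b3) * z a1 a2 a3 + \<omega> b1 (dia b3 b2) * z a3 a1 a2"
    by (simp only: simps) (simp add: algebra_simps)
  show "F (b (tens a1 b1) (tens a2 b2)) (tens a3 b3) + F (b (tens a2 b2) (tens a3 b3)) (tens a1 b1) +
      F (b (tens a3 b3) (tens a1 b1)) (tens a2 b2) =
      \<omega> b1 (dia b2 b3) * l a1 a2 a3 + \<omega> b1 (dia b3 b2) * l a3 a1 a2"
    by (simp only: simps) (simp add: algebra_simps)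
qed

lemma tensor_quasi_frobenius:
  fixes sA :: "'k::field_char_0 \<Rightarrow> 'a::ab_group_add \<Rightarrow> 'a"
  assumes A: "quasi_frobenius_pre_poisson_algebra sA ast circ \<beta>"
    and B: "quadratic_graded_perm_algebra_any_dim sB G dia \<omega>"
    and T: "is_tensor_product sA sB sT tens"
  shows "quasi_frobenius_graded_poisson_algebra_any_dim sT (tensor_grading sT tens G)
    (tensor_mult sT tens ast dia) (tensor_bracket sT tens circ dia) (tensor_form sT tens \<beta> \<omega>)"
proof -
  from A have pp: "pre_poisson_algebra sA ast circ" and \<beta>: "bilinear_form sA \<beta>"
    "symmetric_form \<beta>" "nondegenerate_form \<beta>"
    and z: "\<And>x y z. \<beta> (ast x y + ast y x) z = \<beta> x (ast y z) + \<beta> y (ast x z)"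
    and l: "\<And>x y z. \<beta> (circ x y) z - \<beta> x (circ y z) = \<beta> (circ y x) z - \<beta> y (circ x z)"
    unfolding quasi_frobenius_pre_poisson_algebra_def by blast+
  from B have perm: "perm_algebra sB dia" and G: "int_grading sB G" and dia: "graded_op G dia"
    and \<omega>: "bilinear_form sB \<omega>" "antisymmetric_form \<omega>"
      "\<And>x y z. \<omega> (dia x y) z = \<omega> x (dia y z - dia z y)"
    and \<omega>': "nondegenerate_form \<omega>" "graded_form G \<omega>"
    unfolding quadratic_graded_perm_algebra_any_dim_def by blast+
  have bil: "bilinear_op sA ast" "bilinear_op sA circ" "bilinear_op sB dia"
    using pp perm unfolding pre_poisson_algebra_def zinbiel_algebra_def pre_lie_algebra_def
      perm_algebra_def by auto
  let ?G = "tensor_grading sT tens G"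
  let ?m = "tensor_mult sT tens ast dia" and ?b = "tensor_bracket sT tens circ dia"
  let ?F = "tensor_form sT tens \<beta> \<omega>"
  note m = tensor_mult_props[OF T bil(1,3)] and b = tensor_bracket_props[OF T bil(2,3)]
    and F = tensor_form_props[OF T \<beta>(1) \<omega>(1)]
  note cyc = tensor_cyclic_sums[OF T bil \<beta>(1,2) \<omega>]
  note bs = bilinear_map_simps[OF m(1)] bilinear_map_simps[OF b(1)] bilinear_map_simps[OF F(1)]
  interpret T: vector_space sT using T unfolding is_tensor_product_def by blast
  \<comment> \<open>Both orders are required, because product and bracket of pure tensors involve
    \<open>dia b1 b2\<close> and \<open>dia b2 b1\<close>.\<close>
  have dia_in: "dia x y \<in> G (i + j)" "dia y x \<in> G (i + j)" if "x \<in> G i" "y \<in> G j" for x y i j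
  proof -
    show "dia x y \<in> G (i + j)" using dia that unfolding graded_op_def by blast
    have "dia y x \<in> G (j + i)" using dia that unfolding graded_op_def by blast
    then show "dia y x \<in> G (i + j)" by (simp add: add.commute)
  qed
  have tens_in: "tens a b \<in> ?G i" if "b \<in> G i" for a b i
    unfolding tensor_grading_def using that by (intro T.span_base) blast
  have sub: "T.subspace (?G i)" for i
    unfolding tensor_grading_def by (rule T.subspace_span)
  have gm: "graded_op ?G ?m"
    by (rule tensor_graded_op[OF T G m(1)])
      (simp add: m(2) T.subspace_add[OF sub] tens_in dia_in)
  have gb: "graded_op ?G ?b"
    by (rule tensor_graded_op[OF T G b(1)])
      (simp add: b(2) T.subspace_diff[OF sub] tens_in dia_in)
  have anti: "antisymmetric_form ?F"
    by (rule tensor_form_antisymmetric[OF T \<beta>(1,2) \<omega>(1,2)])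
  have nondeg: "nondegenerate_form ?F"
    by (rule antisymmetric_nondegenerateI[OF anti])
      (rule tensor_form_nondegenerate_left[OF T \<beta>(1,3) \<omega>(1) \<omega>'(1)])
  \<comment> \<open>On pure tensors \<open>cyc\<close> produces the defects, which \<open>z\<close>
    makes vanish; the other goals are additivity.\<close>
  have "?F (?m x y) z + ?F (?m y z) x + ?F (?m z x) y = 0" for x y z
    by (rule tensor_triadditive_eq_0[OF T,
          where f = "\<lambda>x y z. ?F (?m x y) z + ?F (?m y z) x + ?F (?m z x) y"])
      (simp_all only: cyc z, simp_all add: bs algebra_simps)
  moreover have "?F (?b x y) z + ?F (?b y z) x + ?F (?b z x) y = 0" for x y z
    by (rule tensor_triadditive_eq_0[OF T,
          where f = "\<lambda>x y z. ?F (?b x y) z + ?F (?b y z) x + ?F (?b z x) y"])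
      (simp_all only: cyc l, simp_all add: bs algebra_simps)
  ultimately show ?thesis
    unfolding quasi_frobenius_graded_poisson_algebra_any_dim_def
    using tensor_poisson_algebra[OF pp perm T] tensor_int_grading[OF G T] gm gb F(1) anti nondeg
      tensor_graded_form[OF T G \<beta>(1) \<omega>(1) \<omega>'(2)]
    by blast
qed

text \<open>The universal property gives a linear map sending \<open>tens x y\<close> to
  \<open>\<omega> b0 y\<close> times \<open>x\<close>, which recovers \<open>a\<close> up to a
  nonzero scalar.\<close>

lemma tens_eq_0_imp_left_eq_0:
  assumes T: "is_tensor_product sA sB sT tens" and \<omega>: "bilinear_form sB \<omega>"
    and b: "\<omega> b0 b \<noteq> 0" and 0: "tens a b = 0"
  shows "a = 0"
proof -
  interpret A: vector_space sA using T unfolding is_tensor_product_def by blast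
  have "bilinear_map sA sB sA (\<lambda>x y. sA (\<omega> b0 y) x)"
    using T \<omega> unfolding bilinear_map_def Vector_Spaces.linear_iff is_tensor_product_def
    by (simp add: bilinear_map_simps[OF \<omega>] A.scale_left_distrib A.scale_right_distrib
        mult.commute)
  then obtain g where g: "Vector_Spaces.linear sT sA g" "\<And>x y. g (tens x y) = sA (\<omega> b0 y) x"
    using tensor_universal[OF T] by blast
  interpret g: Vector_Spaces.linear sT sA g by (rule g(1))
  have "sA (\<omega> b0 b) a = 0" using g(2)[of a b] 0 g.zero by simp
  then show ?thesis using b by simp
qed

text \<open>
  \<open>b\<^sub>3, b\<^sub>4, b\<^sub>5\<close> isolate one of the two coefficients in \<open>tensor_cyclic_sums\<close>.
\<close>

lemma tensor_quasi_frobenius_converse: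
  assumes pp: "pre_poisson_algebra sA ast circ" and \<beta>: "bilinear_form sA \<beta>"
    and dia: "bilinear_op sB dia"
    and \<omega>: "bilinear_form sB \<omega>" "antisymmetric_form \<omega>"
      "\<And>x y z. \<omega> (dia x y) z = \<omega> x (dia y z - dia z y)"
    and b: "\<omega> b1 b2 \<noteq> 0" "\<omega> b3 (dia b4 b5) \<noteq> 0" "\<omega> b3 (dia b5 b4) = 0"
    and T: "is_tensor_product sA sB sT tens"
    and P: "quasi_frobenius_graded_poisson_algebra_any_dim sT G
      (tensor_mult sT tens ast dia) (tensor_bracket sT tens circ dia) (tensor_form sT tens \<beta> \<omega>)"
  shows "quasi_frobenius_pre_poisson_algebra sA ast circ \<beta>"
proof -
  have bil: "bilinear_op sA ast" "bilinear_op sA circ"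
    using pp unfolding pre_poisson_algebra_def zinbiel_algebra_def pre_lie_algebra_def by auto
  let ?m = "tensor_mult sT tens ast dia" and ?b = "tensor_bracket sT tens circ dia"
  let ?F = "tensor_form sT tens \<beta> \<omega>"
  note F = tensor_form_props[OF T \<beta> \<omega>(1)]
  from P have anti: "\<And>x y. ?F x y = - ?F y x"
    and nondeg: "\<And>x. (\<And>y. ?F x y = 0) \<Longrightarrow> x = 0"
    and cyc: "\<And>x y z. ?F (?m x y) z + ?F (?m y z) x + ?F (?m z x) y = 0"
      "\<And>x y z. ?F (?b x y) z + ?F (?b y z) x + ?F (?b z x) y = 0"
    unfolding quasi_frobenius_graded_poisson_algebra_any_dim_def antisymmetric_form_def
      nondegenerate_form_def by blast+
  \<comment> \<open>Both \<open>?F\<close> and \<open>\<omega>\<close> are antisymmetric, so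
    symmetry of \<open>\<beta>\<close> follows by cancelling a nonzero value of
    \<open>\<omega>\<close>.\<close>
  have sym: "\<beta> x y = \<beta> y x" for x y
  proof -
    have "\<omega> b2 b1 = - \<omega> b1 b2" using \<omega>(2) unfolding antisymmetric_form_def by blast
    then have "\<beta> x y * \<omega> b1 b2 = \<beta> y x * \<omega> b1 b2"
      using anti[of "tens x b1" "tens y b2"] by (simp add: F(2))
    then show ?thesis using b(1) by simp
  qed
  then have symF: "symmetric_form \<beta>" unfolding symmetric_form_def by blast
  \<comment> \<open>If \<open>x\<close> is in the radical of \<open>\<beta>\<close>, then
    \<open>tens x b2\<close> is in the radical of \<open>?F\<close>; \<open>b2\<close> is chosen
    because \<open>b1\<close> pairs nontrivially with it.\<close>
  have left: "x = 0" if x: "\<forall>y. \<beta> x y = 0" for x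
  proof -
    have "?F (tens x b2) t = 0" for t
      by (induction t rule: tensor_induct[OF T]) (simp_all add: F(2) x bilinear_map_simps[OF F(1)])
    then have "tens x b2 = 0" by (rule nondeg)
    then show ?thesis by (rule tens_eq_0_imp_left_eq_0[OF T \<omega>(1) b(1)])
  qed
  have right: "y = 0" if "\<forall>x. \<beta> x y = 0" for y
    using left[of y] that sym[of y] by simp
  note sums = tensor_cyclic_sums[OF T bil dia \<beta> symF \<omega>]
  have "\<beta> (ast x y + ast y x) z = \<beta> x (ast y z) + \<beta> y (ast x z)" for x y z
    using sums(1)[of x b3 y b4 z b5] b(2,3) by (simp add: cyc diff_diff_eq)
  moreover have "\<beta> (circ x y) z - \<beta> x (circ y z) = \<beta> (circ y x) z - \<beta> y (circ x z)" for x y z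
    using sums(2)[of x b3 y b4 z b5] b(2,3) by (simp add: cyc)
  ultimately show ?thesis
    unfolding quasi_frobenius_pre_poisson_algebra_def nondegenerate_form_def
    using pp \<beta> symF left right by blast
qed

section \<open>The Laurent perm algebra\<close>

text \<open>Monomials with opposite exponents are dual under the constant-term pairing;
  nondegeneracy of \<open>laurent_form\<close> rests on this.\<close>

lemma lookup_mult_single_zero:
  fixes f :: "'x::ab_group_add \<Rightarrow>\<^sub>0 'k::semiring_1"
  shows "Poly_Mapping.lookup (f * Poly_Mapping.single (- k) 1) 0 = Poly_Mapping.lookup f k"
proof -
  have *: "((1 when - k = q) when l + q = 0) = (((1::'k) when l = k) when q = - k)" for l q :: 'x
    by (auto simp: when_def add_eq_0_iff2)
  show ?thesis
    by (simp add: lookup_mult lookup_single * mult_when)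
qed

text \<open>Written as a \<open>free_extend\<close> so that linearity comes from
  \<open>linear_free_extend\<close>.\<close>

definition degree_part :: "int \<Rightarrow> 'k::field laurent \<Rightarrow> 'k laurent" where
  "degree_part n =
     free_extend free_scale (\<lambda>k. if fst k + snd k = n then Poly_Mapping.single k 1 else 0)"

lemma lookup_degree_part:
  "Poly_Mapping.lookup (degree_part n f) k =
    (if fst k + snd k = n then Poly_Mapping.lookup f k else 0)"
proof -
  have "Poly_Mapping.lookup (degree_part n f) k = (\<Sum>p\<in>Poly_Mapping.keys f.
      if p = k then (if fst k + snd k = n then Poly_Mapping.lookup f k else 0) else 0)"
    unfolding degree_part_def free_extend_def lookup_sum
    by (intro sum.cong) (auto simp: lookup_single when_def)
  then show ?thesis by (auto simp: in_keys_iff)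
qed

definition laurent_projection :: "int \<Rightarrow> 'k::field laurent_der \<Rightarrow> 'k laurent_der" where
  "laurent_projection i = map_prod (degree_part (i - 1)) (degree_part (i - 1))"

lemma laurent_der_eqI:
  assumes "\<And>k. Poly_Mapping.lookup (fst f) k = Poly_Mapping.lookup (fst g) k"
    "\<And>k. Poly_Mapping.lookup (snd f) k = Poly_Mapping.lookup (snd g) k"
  shows "f = (g :: 'k::field laurent_der)"
  using assms by (intro prod_eqI poly_mapping_eqI)

lemma laurent_grading_iff:
  "f \<in> laurent_grading i \<longleftrightarrow> (\<forall>k. fst k + snd k \<noteq> i - 1 \<longrightarrow>
    Poly_Mapping.lookup (fst f) k = 0 \<and> Poly_Mapping.lookup (snd f) k = 0)"
  unfolding laurent_grading_def by (fastforce simp: in_keys_iff)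

lemma laurent_subspace: "module.subspace laurent_scale (laurent_grading i)"
proof -
  interpret vector_space laurent_scale by (rule vector_space_laurent_scale)
  show ?thesis
    by (rule subspaceI) (simp_all add: laurent_grading_iff lookup_add laurent_scale_def)
qed

lemma laurent_grading_projections:
  "grading_projections laurent_scale laurent_grading
     (laurent_projection :: int \<Rightarrow> 'k::field laurent_der \<Rightarrow> 'k laurent_der)"
proof -
  note lookups = laurent_projection_def laurent_scale_def lookup_degree_part lookup_add
  have lin: "Vector_Spaces.linear laurent_scale laurent_scale
      (laurent_projection i :: 'k laurent_der \<Rightarrow> _)" for i
    unfolding Vector_Spaces.linear_iff
    using vector_space_laurent_scale linear_free_extend[OF vector_space_free_scale]
    by (auto simp: laurent_projection_def laurent_scale_def degree_part_def
        Vector_Spaces.linear_iff)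
  have hom: "laurent_projection i x = (if i = j then x else 0)"
    if "x \<in> laurent_grading j" for i j and x :: "'k laurent_der"
    using that by (auto simp: lookups laurent_grading_iff intro!: laurent_der_eqI)
  have mem: "laurent_projection i x \<in> laurent_grading i" for i and x :: "'k laurent_der"
    by (simp add: lookups laurent_grading_iff)
  have fin: "finite {i. laurent_projection i x \<noteq> 0}" for x :: "'k laurent_der"
  proof (rule finite_subset)
    let ?K = "Poly_Mapping.keys (fst x) \<union> Poly_Mapping.keys (snd x)"
    show "{i. laurent_projection i x \<noteq> 0} \<subseteq> (\<lambda>k. fst k + snd k + 1) ` ?K"
    proof
      fix i assume "i \<in> {i. laurent_projection i x \<noteq> 0}"
      then have "\<exists>k. Poly_Mapping.lookup (fst (laurent_projection i x)) k \<noteq> 0 \<or>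
          Poly_Mapping.lookup (snd (laurent_projection i x)) k \<noteq> 0"
        using laurent_der_eqI[of "laurent_projection i x" 0] by auto
      then obtain k where "fst k + snd k = i - 1" "k \<in> ?K"
        by (auto simp: lookups in_keys_iff split: if_splits)
      then show "i \<in> (\<lambda>k. fst k + snd k + 1) ` ?K" by (intro image_eqI[of _ _ k]) auto
    qed
  qed simp
  have sum: "x = (\<Sum>i | laurent_projection i x \<noteq> 0. laurent_projection i x)"
    for x :: "'k laurent_der"
  proof (rule laurent_der_eqI)
    fix k :: "int \<times> int"
    let ?S = "{i. laurent_projection i x \<noteq> 0}" and ?d = "fst k + snd k + 1"
    \<comment> \<open>Only the index \<open>?d\<close> can contribute to the exponent
      \<open>k\<close>, the summand 1 undoing the degree shift; if \<open>?d\<close> is outside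
      \<open>?S\<close>, the coefficient there is 0 anyway.\<close>
    have d: "?d \<in> ?S" if "Poly_Mapping.lookup (fst (laurent_projection ?d x)) k \<noteq> 0 \<or>
        Poly_Mapping.lookup (snd (laurent_projection ?d x)) k \<noteq> 0"
      using that by auto
    have "(\<Sum>i\<in>?S. Poly_Mapping.lookup (fst (laurent_projection i x)) k) =
        (\<Sum>i\<in>?S. if i = ?d then Poly_Mapping.lookup (fst x) k else 0)"
      by (intro sum.cong) (auto simp: lookups)
    also have "\<dots> = Poly_Mapping.lookup (fst x) k"
      using fin[of x] d by (auto simp: lookups)
    finally show "Poly_Mapping.lookup (fst x) k =
        Poly_Mapping.lookup (fst (\<Sum>i\<in>?S. laurent_projection i x)) k"
      by (simp add: fst_sum lookup_sum)
    have "(\<Sum>i\<in>?S. Poly_Mapping.lookup (snd (laurent_projection i x)) k) =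
        (\<Sum>i\<in>?S. if i = ?d then Poly_Mapping.lookup (snd x) k else 0)"
      by (intro sum.cong) (auto simp: lookups)
    also have "\<dots> = Poly_Mapping.lookup (snd x) k"
      using fin[of x] d by (auto simp: lookups)
    finally show "Poly_Mapping.lookup (snd x) k =
        Poly_Mapping.lookup (snd (\<Sum>i\<in>?S. laurent_projection i x)) k"
      by (simp add: snd_sum lookup_sum)
  qed
  show ?thesis
    unfolding grading_projections_def using lin hom mem fin sum by blast
qed

definition homogeneous :: "int \<Rightarrow> 'k::field laurent \<Rightarrow> bool" where
  "homogeneous n f \<longleftrightarrow> (\<forall>k\<in>Poly_Mapping.keys f. fst k + snd k = n)"

lemma homogeneous_mult:
  assumes "homogeneous m f" "homogeneous n g"
  shows "homogeneous (m + n) (f * g)"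
  unfolding homogeneous_def
proof
  fix k assume "k \<in> Poly_Mapping.keys (f * g)"
  then obtain a b where "k = a + b" "a \<in> Poly_Mapping.keys f" "b \<in> Poly_Mapping.keys g"
    using keys_mult[of f g] by blast
  then show "fst k + snd k = m + n" using assms unfolding homogeneous_def by force
qed

lemma homogeneous_add: "homogeneous n f \<Longrightarrow> homogeneous n g \<Longrightarrow> homogeneous n (f + g)"
  unfolding homogeneous_def using keys_add[of f g] by blast

lemma homogeneous_diff: "homogeneous n f \<Longrightarrow> homogeneous n g \<Longrightarrow> homogeneous n (f - g)"
  unfolding homogeneous_def using keys_diff[of f g] by blast

lemma laurent_grading_homogeneous:
  "f \<in> laurent_grading i \<longleftrightarrow> homogeneous (i - 1) (fst f) \<and> homogeneous (i - 1) (snd f)"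
  unfolding laurent_grading_def homogeneous_def by fastforce

lemma laurent_quadratic:
  "quadratic_graded_perm_algebra_any_dim laurent_scale laurent_grading laurent_perm
     (laurent_form :: 'k::field laurent_der \<Rightarrow> _)"
proof -
  have perm: "perm_algebra laurent_scale (laurent_perm :: 'k laurent_der \<Rightarrow> _)"
    unfolding perm_algebra_def
    using laurent_perm_bilinear by (simp add: laurent_perm_def Let_def algebra_simps)
  \<comment> \<open>Invariance already holds between the Laurent polynomials, before the constant
    term is taken.\<close>
  have inv: "laurent_form (laurent_perm x y) z =
      laurent_form x (laurent_perm y z - laurent_perm z y)" for x y z :: "'k laurent_der"
    unfolding laurent_form_def
    by (rule arg_cong[where f = "\<lambda>h. Poly_Mapping.lookup h (0, 0)"])
      (simp add: laurent_perm_def Let_def algebra_simps)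
  have anti: "antisymmetric_form (laurent_form :: 'k laurent_der \<Rightarrow> _)"
    unfolding antisymmetric_form_def laurent_form_def by (simp add: lookup_minus mult.commute)
  have nondeg: "nondegenerate_form (laurent_form :: 'k laurent_der \<Rightarrow> _)"
  proof (rule antisymmetric_nondegenerateI[OF anti])
    fix x :: "'k laurent_der" assume x: "\<And>y. laurent_form x y = 0"
    show "x = 0"
    proof (rule laurent_der_eqI)
      fix k
      \<comment> \<open>The form pairs each derivation with the other one, so a multiple of the
        first derivation tests the second component, and conversely.\<close>
      show "Poly_Mapping.lookup (snd x) k = Poly_Mapping.lookup (snd 0) k"
        using x[of "(Poly_Mapping.single (- k) 1, 0)"] lookup_mult_single_zero[of "snd x" k]
        by (simp add: laurent_form_def zero_prod_def)
      show "Poly_Mapping.lookup (fst x) k = Poly_Mapping.lookup (fst 0) k"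
        using x[of "(0, Poly_Mapping.single (- k) 1)"] lookup_mult_single_zero[of "fst x" k]
        by (simp add: laurent_form_def zero_prod_def)
    qed
  qed
  \<comment> \<open>The extra variable in the product has degree 1 and balances the shift:
    \<open>1 + (i - 1) + (j - 1) = i + j - 1\<close>.\<close>
  have "homogeneous 1 (Poly_Mapping.single (1, 0) 1 :: 'k laurent)"
    "homogeneous 1 (Poly_Mapping.single (0, 1) 1 :: 'k laurent)"
    by (simp_all add: homogeneous_def)
  then have "laurent_perm x y \<in> laurent_grading (i + j)"
    if "x \<in> laurent_grading i" "y \<in> laurent_grading j" for i j and x y :: "'k laurent_der"
  proof -
    let ?h = "Poly_Mapping.single (1, 0) 1 * fst x + Poly_Mapping.single (0, 1) 1 * snd x"
    have "homogeneous (1 + (i - 1)) ?h"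
      using that \<open>homogeneous 1 (Poly_Mapping.single (1, 0) 1)\<close>
        \<open>homogeneous 1 (Poly_Mapping.single (0, 1) 1)\<close>
      unfolding laurent_grading_homogeneous by (intro homogeneous_add homogeneous_mult) auto
    then have "homogeneous (1 + (i - 1) + (j - 1)) (?h * fst y)"
      "homogeneous (1 + (i - 1) + (j - 1)) (?h * snd y)"
      using that unfolding laurent_grading_homogeneous by (auto intro: homogeneous_mult)
    then show ?thesis
      by (simp add: laurent_grading_homogeneous laurent_perm_def Let_def add_diff_eq)
  qed
  then have graded: "graded_op laurent_grading (laurent_perm :: 'k laurent_der \<Rightarrow> _)"
    unfolding graded_op_def by blast
  \<comment> \<open>The constant term has degree 0 and the coefficients have degrees
    \<open>i - 1\<close> and \<open>j - 1\<close>, so the form lives on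
    \<open>i + j = 2\<close>.\<close>
  have "laurent_form x y = 0"
    if "i + j + (- 2) \<noteq> 0" "x \<in> laurent_grading i" "y \<in> laurent_grading j"
    for i j and x y :: "'k laurent_der"
  proof -
    have "homogeneous ((i - 1) + (j - 1)) (snd x * fst y - fst x * snd y)"
      using that(2,3) unfolding laurent_grading_homogeneous
      by (intro homogeneous_diff homogeneous_mult) auto
    then show ?thesis
      using that(1) unfolding homogeneous_def laurent_form_def by (force simp: in_keys_iff)
  qed
  then have gform: "graded_form laurent_grading (laurent_form :: 'k laurent_der \<Rightarrow> _)"
    unfolding graded_form_def by blast
  show ?thesis
    unfolding quadratic_graded_perm_algebra_any_dim_def
    using perm int_gradingI[OF laurent_subspace laurent_grading_projections] graded
      laurent_form_bilinear anti nondeg gform inv by blast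
qed

theorem proposition4p23:
  fixes sA :: "'k::field_char_0 \<Rightarrow> 'a::ab_group_add \<Rightarrow> 'a"
    and ast circ :: "'a \<Rightarrow> 'a \<Rightarrow> 'a"
    and varpi :: "'a \<Rightarrow> 'a \<Rightarrow> 'k"
    and sB :: "'k \<Rightarrow> 'b::ab_group_add \<Rightarrow> 'b"
    and G :: "int \<Rightarrow> 'b set"
    and dia :: "'b \<Rightarrow> 'b \<Rightarrow> 'b"
    and \<omega> :: "'b \<Rightarrow> 'b \<Rightarrow> 'k"
    and sT :: "'k \<Rightarrow> 't::ab_group_add \<Rightarrow> 't"
    and tens :: "'a \<Rightarrow> 'b \<Rightarrow> 't"
    and sL :: "'k \<Rightarrow> 'l::ab_group_add \<Rightarrow> 'l"
    and tensL :: "'a \<Rightarrow> 'k laurent_der \<Rightarrow> 'l"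
  shows
    "(fin_dim sA UNIV \<and>
      quasi_frobenius_pre_poisson_algebra sA ast circ varpi \<and>
      quadratic_graded_perm_algebra sB G dia \<omega> \<and>
      is_tensor_product sA sB sT tens \<longrightarrow>
        quasi_frobenius_graded_poisson_algebra sT (tensor_grading sT tens G)
          (tensor_mult sT tens ast dia) (tensor_bracket sT tens circ dia)
          (tensor_form sT tens varpi \<omega>))
     \<and>
     (fin_dim sA UNIV \<and>
      pre_poisson_algebra sA ast circ \<and>
      bilinear_form sA varpi \<and>
      is_tensor_product sA laurent_scale sL tensL \<longrightarrow>
        (quasi_frobenius_graded_poisson_algebra_any_dim sL (tensor_grading sL tensL laurent_grading)
           (tensor_mult sL tensL ast laurent_perm) (tensor_bracket sL tensL circ laurent_perm)
           (tensor_form sL tensL varpi laurent_form)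
         \<longleftrightarrow> quasi_frobenius_pre_poisson_algebra sA ast circ varpi))"
proof (intro conjI impI)
  assume H: "fin_dim sA UNIV \<and> quasi_frobenius_pre_poisson_algebra sA ast circ varpi \<and>
      quadratic_graded_perm_algebra sB G dia \<omega> \<and> is_tensor_product sA sB sT tens"
  then have B: "quadratic_graded_perm_algebra_any_dim sB G dia \<omega>" "fin_dim_components sB G"
    unfolding quadratic_graded_perm_algebra_def quadratic_graded_perm_algebra_any_dim_def by blast+
  show "quasi_frobenius_graded_poisson_algebra sT (tensor_grading sT tens G)
      (tensor_mult sT tens ast dia) (tensor_bracket sT tens circ dia)
      (tensor_form sT tens varpi \<omega>)"
    unfolding quasi_frobenius_graded_poisson_algebra_def
    using H tensor_quasi_frobenius[OF _ B(1)] tensor_fin_dim_components[OF _ B(2)] by blast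
next
  assume H: "fin_dim sA UNIV \<and> pre_poisson_algebra sA ast circ \<and> bilinear_form sA varpi \<and>
      is_tensor_product sA laurent_scale sL tensL"
  then have T: "is_tensor_product sA laurent_scale sL tensL" by blast
  let ?x = "laurent_monom 1 0 0 :: 'k laurent_der" and ?y = "laurent_monom 2 0 0 :: 'k laurent_der"
  let ?u = "laurent_monom 1 (- 1) 0 :: 'k laurent_der"
  from laurent_quadratic
  have L: "antisymmetric_form (laurent_form :: 'k laurent_der \<Rightarrow> _)"
    "\<And>x y z :: 'k laurent_der. laurent_form (laurent_perm x y) z =
      laurent_form x (laurent_perm y z - laurent_perm z y)"
    unfolding quadratic_graded_perm_algebra_any_dim_def by blast+
  \<comment> \<open>Here \<open>laurent_perm ?x ?y = laurent_monom 2 1 0\<close>, whose exponents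
    cancel those of \<open>?u\<close>, whereas
    \<open>laurent_perm ?y ?x = laurent_monom 1 0 1\<close> involves the same derivation as
    \<open>?u\<close>. Without \<open>One_nat_def\<close> the index 1 stays in the form that the
    monomial rules match.\<close>
  have b: "laurent_form ?y ?x \<noteq> 0" "laurent_form ?u (laurent_perm ?x ?y) \<noteq> 0"
    "laurent_form ?u (laurent_perm ?y ?x) = 0"
    by (simp_all add: laurent_perm_monom laurent_form_monom del: One_nat_def)
  show "quasi_frobenius_graded_poisson_algebra_any_dim sL (tensor_grading sL tensL laurent_grading)
           (tensor_mult sL tensL ast laurent_perm) (tensor_bracket sL tensL circ laurent_perm)
           (tensor_form sL tensL varpi laurent_form)
         \<longleftrightarrow> quasi_frobenius_pre_poisson_algebra sA ast circ varpi"
    using tensor_quasi_frobenius[OF _ laurent_quadratic T]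
      tensor_quasi_frobenius_converse[OF _ _ laurent_perm_bilinear laurent_form_bilinear L b T] H
    by blast
qed

end
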